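(* Let $h:\mathbb{R}\to(0,\infty)$ be a smooth $1$-periodic function and, for $l\in\mathbb{Z}$, let $$H_l=-\frac{d^2}{dt^2}+4\pi^2l^2-4\pi l\,\frac{h'(t)}{h(t)}-\frac{h(t)h''(t)-2(h'(t))^2}{h^2(t)}$$ acting on $1$-periodic functions of $t$. For $l\neq0$ the operator $H_l$ is strictly positive, and $H_0$ is a non-negative operator.
   Context: Positivity is meant with respect to the inner product of $L^2([0,1])$ (periodic boundary conditions): non-negative means the spectrum is contained in $[0,\infty)$, strictly positive means it is contained in $(0,\infty)$. *)

theory Defs
  imports "HOL-Analysis.Analysis"
begin

definition smooth_real :: "(real \<Rightarrow> real) \<Rightarrow> bool" where
  "smooth_real h \<longleftrightarrow> (\<forall>n t. (deriv ^^ n) h field_differentiable at t)"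

definition periodic1 :: "(real \<Rightarrow> 'a) \<Rightarrow> bool" where
  "periodic1 f \<longleftrightarrow> (\<forall>t. f (t + 1) = f t)"


section \<open>The Hilbert space of square-integrable functions on the unit interval\<close>

text \<open>
  The space is represented by its complex-valued representatives; equality in it is equality
  almost everywhere on the unit interval, and values outside that interval are irrelevant.
\<close>

abbreviation unit_interval_measure :: "real measure" where
  "unit_interval_measure \<equiv> lebesgue_on {0..1}"

definition L2_unit :: "(real \<Rightarrow> complex) set" where
  "L2_unit = {f. f \<in> borel_measurable unit_interval_measure \<and>
                 integrable unit_interval_measure (\<lambda>t. (cmod (f t))\<^sup>2)}"

definition L2_eq :: "(real \<Rightarrow> complex) \<Rightarrow> (real \<Rightarrow> complex) \<Rightarrow> bool" where
  "L2_eq f g \<longleftrightarrow> (AE t in unit_interval_measure. f t = g t)"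

definition L2_norm :: "(real \<Rightarrow> complex) \<Rightarrow> real" where
  "L2_norm f = sqrt (LINT t|unit_interval_measure. (cmod (f t))\<^sup>2)"


section \<open>Spectrum of an unbounded operator\<close>

text \<open>
  An unbounded operator is given by its graph, a set of pairs of representatives: a pair
  \<open>(u, v)\<close> belongs to it if \<open>u\<close> represents an element of the domain and \<open>v\<close> represents its image.
  A complex number \<open>z\<close> is in the resolvent set if \<open>T - z\<close> maps the domain bijectively onto the
  whole space (up to equality almost everywhere) and the inverse is bounded.
\<close>

type_synonym L2_operator = "((real \<Rightarrow> complex) \<times> (real \<Rightarrow> complex)) set"

definition resolvent_set :: "L2_operator \<Rightarrow> complex set" where
  "resolvent_set T = {z.
     (\<forall>f\<in>L2_unit. \<exists>(u, v)\<in>T. L2_eq (\<lambda>t. v t - z * u t) f) \<and>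
     (\<forall>(u1, v1)\<in>T. \<forall>(u2, v2)\<in>T.
        L2_eq (\<lambda>t. v1 t - z * u1 t) (\<lambda>t. v2 t - z * u2 t) \<longrightarrow> L2_eq u1 u2) \<and>
     (\<exists>C. \<forall>(u, v)\<in>T. L2_norm u \<le> C * L2_norm (\<lambda>t. v t - z * u t))}"

definition spectrum :: "L2_operator \<Rightarrow> complex set" where
  "spectrum T = - resolvent_set T"

definition nonneg_operator :: "L2_operator \<Rightarrow> bool" where
  "nonneg_operator T \<longleftrightarrow> spectrum T \<subseteq> complex_of_real ` {0..}"

definition strictly_pos_operator :: "L2_operator \<Rightarrow> bool" where
  "strictly_pos_operator T \<longleftrightarrow> spectrum T \<subseteq> complex_of_real ` {0<..}"


section \<open>The operators\<close>

text \<open>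
  The domain is the periodic Sobolev space of order two. Its elements are represented by their
  continuously differentiable periodic representatives \<open>u\<close>, whose derivative is the indefinite
  integral of a square-integrable function \<open>w\<close>, the (weak) second derivative of \<open>u\<close>.
  Periodicity of \<open>u\<close> entails periodicity of its derivative, so the last condition
  need only be imposed on one period.
\<close>

definition periodic_H2 :: "(real \<Rightarrow> complex) \<Rightarrow> (real \<Rightarrow> complex) \<Rightarrow> bool" where
  "periodic_H2 u w \<longleftrightarrow> periodic1 u \<and> w \<in> L2_unit \<and>
     (\<exists>u'. (\<forall>t. (u has_vector_derivative u' t) (at t)) \<and>
           (\<forall>t\<in>{0..1}. u' t = u' 0 + (LINT s|lebesgue_on {0..t}. w s)))"

definition potential :: "(real \<Rightarrow> real) \<Rightarrow> int \<Rightarrow> real \<Rightarrow> real" where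
  "potential h l t =
     4 * pi\<^sup>2 * (of_int l)\<^sup>2 - 4 * pi * of_int l * (deriv h t / h t)
     - (h t * deriv (deriv h) t - 2 * (deriv h t)\<^sup>2) / (h t)\<^sup>2"

definition H_op :: "(real \<Rightarrow> real) \<Rightarrow> int \<Rightarrow> L2_operator" where
  "H_op h l = {(u, v). v \<in> L2_unit \<and>
     (\<exists>w. periodic_H2 u w \<and> L2_eq v (\<lambda>t. - w t + complex_of_real (potential h l t) * u t))}"

end

theory Submission
  imports Defs
begin

text \<open>
  With \<open>p = 2 \<pi> l - h'/h\<close> the potential is \<open>p\<^sup>2 + p'\<close>, so that \<open>H = B\<^sup>* B\<close> for \<open>B = - d/dt + p\<close>
  and the quadratic form of \<open>H\<close> is \<open>\<parallel>B u\<parallel>\<^sup>2\<close>. Hence \<open>H - z\<close> is coercive for every \<open>z\<close> off the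
  half-line \<open>[0,\<infinity>)\<close>. For \<open>l \<noteq> 0\<close> the solutions of \<open>B u = 0\<close> are the multiples of
  \<open>exp (2 \<pi> l t) / h\<close>, which are not periodic, and \<open>H\<close> itself is coercive. Coercivity gives
  injectivity and the bound on the inverse. Surjectivity is the Fredholm alternative for a
  second-order linear equation: it has a solution for any initial data, and since the homogeneous
  equation has no nontrivial periodic solution, the initial data can be chosen to make the solution
  periodic.
\<close>

section \<open>Square-integrable functions\<close>

lemma L2_unit_measurable: "f \<in> L2_unit \<Longrightarrow> f \<in> borel_measurable unit_interval_measure"
  by (simp add: L2_unit_def)

lemma L2_unit_integrable_power2:
  "f \<in> L2_unit \<Longrightarrow> integrable unit_interval_measure (\<lambda>t. (cmod (f t))\<^sup>2)"
  by (simp add: L2_unit_def)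

lemma continuous_in_L2_unit:
  assumes "continuous_on {0..1} f"
  shows "f \<in> L2_unit"
proof -
  have "integrable unit_interval_measure (\<lambda>t. (cmod (f t))\<^sup>2)"
    by (intro continuous_imp_integrable_real continuous_intros assms)
  moreover have "f \<in> borel_measurable unit_interval_measure"
    by (intro continuous_imp_measurable_on_sets_lebesgue assms) simp
  ultimately show ?thesis by (simp add: L2_unit_def)
qed

lemma L2_unit_cmult: "f \<in> L2_unit \<Longrightarrow> (\<lambda>t. c * f t) \<in> L2_unit"
  by (auto simp: L2_unit_def norm_mult power_mult_distrib)

lemma L2_unit_mult_integrable:
  assumes "f \<in> L2_unit" "g \<in> L2_unit"
  shows "integrable unit_interval_measure (\<lambda>t. f t * g t)"
proof (rule Bochner_Integration.integrable_bound)
  show "integrable unit_interval_measure (\<lambda>t. (cmod (f t))\<^sup>2 + (cmod (g t))\<^sup>2)"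
    using assms by (auto simp: L2_unit_def)
  show "(\<lambda>t. f t * g t) \<in> borel_measurable unit_interval_measure"
    using assms by (auto simp: L2_unit_def)
  have "cmod (f t * g t) \<le> (cmod (f t))\<^sup>2 + (cmod (g t))\<^sup>2" for t
    using sum_squares_bound[of "cmod (f t)" "cmod (g t)"]
      mult_nonneg_nonneg[OF norm_ge_zero[of "f t"] norm_ge_zero[of "g t"]]
    unfolding norm_mult by linarith
  then show "AE t in unit_interval_measure.
      norm (f t * g t) \<le> norm ((cmod (f t))\<^sup>2 + (cmod (g t))\<^sup>2)"
    by (auto intro!: AE_I2)
qed

lemma L2_unit_cnj: "f \<in> L2_unit \<Longrightarrow> (\<lambda>t. cnj (f t)) \<in> L2_unit"
  using measurable_compose[OF L2_unit_measurable[of f] borel_measurable_continuous_onI[of cnj]]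
  by (simp add: L2_unit_def continuous_on_cnj)

lemma L2_unit_add:
  assumes "f \<in> L2_unit" "g \<in> L2_unit"
  shows "(\<lambda>t. f t + g t) \<in> L2_unit"
proof -
  have "integrable unit_interval_measure (\<lambda>t. (cmod (f t + g t))\<^sup>2)"
  proof (rule Bochner_Integration.integrable_bound)
    show "integrable unit_interval_measure (\<lambda>t. 2 * (cmod (f t))\<^sup>2 + 2 * (cmod (g t))\<^sup>2)"
      using assms by (auto simp: L2_unit_def)
    show "(\<lambda>t. (cmod (f t + g t))\<^sup>2) \<in> borel_measurable unit_interval_measure"
      using assms by (auto simp: L2_unit_def)
    have "(cmod (f t + g t))\<^sup>2 \<le> 2 * (cmod (f t))\<^sup>2 + 2 * (cmod (g t))\<^sup>2" for t
    proof -
      have "(cmod (f t + g t))\<^sup>2 \<le> (cmod (f t) + cmod (g t))\<^sup>2"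
        by (intro power_mono norm_triangle_ineq) auto
      then show ?thesis
        using sum_squares_bound[of "cmod (f t)" "cmod (g t)"] by (simp add: power2_sum)
    qed
    then show "AE t in unit_interval_measure. norm ((cmod (f t + g t))\<^sup>2)
        \<le> norm (2 * (cmod (f t))\<^sup>2 + 2 * (cmod (g t))\<^sup>2)"
      by (auto intro!: AE_I2)
  qed
  with assms show ?thesis by (auto simp: L2_unit_def)
qed

lemma L2_unit_diff:
  assumes "f \<in> L2_unit" "g \<in> L2_unit"
  shows "(\<lambda>t. f t - g t) \<in> L2_unit"
  using L2_unit_add[OF assms(1) L2_unit_cmult[OF assms(2), of "-1"]] by simp

text \<open>The interval has finite measure, so the constant 1 is square-integrable and can serve as
  the second factor of an integrable product.\<close>

lemma L2_unit_integrable: "f \<in> L2_unit \<Longrightarrow> integrable unit_interval_measure f"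
  using L2_unit_mult_integrable[of f "\<lambda>_. 1"] continuous_in_L2_unit[of "\<lambda>_. 1"] by auto

lemma L2_eq_refl: "L2_eq f f"
  by (simp add: L2_eq_def)

lemma L2_norm_cong: "L2_eq f g \<Longrightarrow> f \<in> L2_unit \<Longrightarrow> g \<in> L2_unit \<Longrightarrow> L2_norm f = L2_norm g"
  unfolding L2_norm_def L2_eq_def
  by (intro arg_cong[of _ _ sqrt] integral_cong_AE) (auto simp: L2_unit_def elim: eventually_mono)

lemma L2_norm_eq_0_imp:
  assumes "f \<in> L2_unit" "L2_norm f = 0"
  shows "L2_eq f (\<lambda>_. 0)"
proof -
  have "(LINT t|unit_interval_measure. (cmod (f t))\<^sup>2) = 0"
    using assms(2) by (simp add: L2_norm_def)
  then have "AE t in unit_interval_measure. (cmod (f t))\<^sup>2 = 0"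
    using integral_nonneg_eq_0_iff_AE[OF L2_unit_integrable_power2[OF assms(1)]] by auto
  then show ?thesis by (simp add: L2_eq_def)
qed

lemma L2_norm_power2: "(L2_norm f)\<^sup>2 = (LINT t|unit_interval_measure. (cmod (f t))\<^sup>2)"
  unfolding L2_norm_def by (intro real_sqrt_pow2 integral_nonneg_AE) auto

lemma L2_norm_nonneg [simp]: "0 \<le> L2_norm f"
  unfolding L2_norm_def by (simp add: integral_nonneg_AE)

lemma L2_norm_zero: "L2_norm (\<lambda>_. 0) = 0"
  by (simp add: L2_norm_def)

section \<open>Coercivity and the a priori bound\<close>

text \<open>A weighted Young inequality under the integral, in place of Cauchy-Schwarz: the free
  weight \<open>d\<close> allows the term in \<open>f\<close> to be absorbed by a coercive left-hand
  side.\<close>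

lemma norm_inner_L2_le:
  assumes "f \<in> L2_unit" "g \<in> L2_unit" "0 < d"
  shows "cmod (LINT t|unit_interval_measure. f t * g t)
    \<le> d / 2 * (L2_norm f)\<^sup>2 + (L2_norm g)\<^sup>2 / (2 * d)"
proof -
  have "cmod (LINT t|unit_interval_measure. f t * g t)
      \<le> (LINT t|unit_interval_measure. cmod (f t * g t))"
    by (rule integral_norm_bound)
  also have "\<dots> \<le> (LINT t|unit_interval_measure.
      d / 2 * (cmod (f t))\<^sup>2 + (cmod (g t))\<^sup>2 / (2 * d))"
  proof (rule integral_mono)
    show "integrable unit_interval_measure (\<lambda>t. cmod (f t * g t))"
      by (intro integrable_norm L2_unit_mult_integrable assms)
    show "integrable unit_interval_measure
        (\<lambda>t. d / 2 * (cmod (f t))\<^sup>2 + (cmod (g t))\<^sup>2 / (2 * d))"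
      using assms by (auto simp: L2_unit_def)
    \<comment> \<open>This is the square of \<open>d * cmod (f t) - cmod (g t)\<close> being
      non-negative, divided by \<open>2 * d\<close>.\<close>
    show "cmod (f t * g t) \<le> d / 2 * (cmod (f t))\<^sup>2 + (cmod (g t))\<^sup>2 / (2 * d)" for t
      using assms(3) sum_squares_bound[of "d * cmod (f t)" "cmod (g t)"]
      by (simp add: norm_mult field_simps power2_eq_square)
  qed
  also have "\<dots> = d / 2 * (L2_norm f)\<^sup>2 + (L2_norm g)\<^sup>2 / (2 * d)"
    unfolding L2_norm_power2 using assms(1,2) by (simp add: L2_unit_def)
  finally show ?thesis .
qed

text \<open>With the coercivity constant as weight, half of the left-hand side absorbs the term in
  \<open>u\<close>. For \<open>f\<close> the image of \<open>u\<close> under \<open>T - z\<close>,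
  this is the bound on the resolvent, with constant \<open>1 / d\<close>.\<close>

lemma L2_norm_bound_of_coercive:
  assumes "u \<in> L2_unit" "f \<in> L2_unit" "0 < d"
    and "d * (L2_norm u)\<^sup>2 \<le> cmod (LINT t|unit_interval_measure. cnj (u t) * f t)"
  shows "L2_norm u \<le> 1 / d * L2_norm f"
proof -
  have "L2_norm (\<lambda>t. cnj (u t)) = L2_norm u"
    by (simp add: L2_norm_def)
  then have "d / 2 * (L2_norm u)\<^sup>2 \<le> (L2_norm f)\<^sup>2 / (2 * d)"
    using norm_inner_L2_le[OF L2_unit_cnj[OF assms(1)] assms(2,3)] assms(4) by simp
  then have "(d * L2_norm u)\<^sup>2 \<le> (L2_norm f)\<^sup>2"
    using assms(3) by (simp add: field_simps power2_eq_square)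
  then have "d * L2_norm u \<le> L2_norm f"
    by (rule power2_le_imp_le) simp
  then show ?thesis
    using assms(3) by (simp add: field_simps)
qed

section \<open>Integration by parts against a primitive\<close>

lemma continuous_on_Icc_norm_bounded:
  fixes f :: "real \<Rightarrow> 'a::real_normed_vector"
  assumes "continuous_on {a..b} f"
  obtains B where "\<And>s. s \<in> {a..b} \<Longrightarrow> norm (f s) \<le> B"
proof -
  have "bounded (f ` {a..b})"
    by (rule compact_imp_bounded[OF compact_continuous_image[OF assms compact_Icc]])
  then obtain B where "\<forall>x\<in>f ` {a..b}. norm x \<le> B"
    unfolding bounded_iff by blast
  with that show thesis by blast
qed

text \<open>The primitive of an integrable function is only absolutely continuous, so the formula
  comes from Fubini's theorem on the triangle \<open>t \<le> s\<close> rather than from the product rule.\<close>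

lemma integral_by_parts_primitive:
  fixes w \<phi> \<phi>' :: "real \<Rightarrow> complex"
  assumes w: "integrable unit_interval_measure w"
    and \<phi>: "\<And>t. t \<in> {0..1} \<Longrightarrow> (\<phi> has_vector_derivative \<phi>' t) (at t within {0..1})"
    and \<phi>': "continuous_on {0..1} \<phi>'"
  shows "(LINT t|unit_interval_measure. \<phi> t * w t) = \<phi> 1 * (LINT t|unit_interval_measure. w t)
    - (LINT s|unit_interval_measure. \<phi>' s * (LINT t|lebesgue_on {0..s}. w t))"
proof -
  let ?M = unit_interval_measure
  interpret M: finite_measure ?M
    by (rule finite_measure_lebesgue_on) simp
  interpret P: pair_sigma_finite ?M ?M ..
  \<comment> \<open>Integrating \<open>F\<close> over \<open>s\<close> first produces
    \<open>w t * (\<phi> 1 - \<phi> t)\<close>; integrating over \<open>t\<close> first produces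
    \<open>\<phi>' s\<close> times the primitive of \<open>w\<close> at \<open>s\<close>.\<close>
  define F where "F t s = (if t \<le> s then w t * \<phi>' s else 0)" for t s :: real
  have w_meas [measurable]: "w \<in> borel_measurable ?M"
    using w by auto
  have \<phi>'_meas [measurable]: "\<phi>' \<in> borel_measurable ?M"
    using \<phi>' by (rule continuous_imp_measurable_on_sets_lebesgue) simp
  have id_meas [measurable]: "(\<lambda>x. x) \<in> borel_measurable ?M"
    by (rule continuous_imp_measurable_on_sets_lebesgue[OF continuous_on_id]) simp
  have F_meas: "case_prod F \<in> borel_measurable (?M \<Otimes>\<^sub>M ?M)"
    unfolding F_def by measurable
  obtain B where B: "\<And>s. s \<in> {0..1} \<Longrightarrow> cmod (\<phi>' s) \<le> B"
    using continuous_on_Icc_norm_bounded[OF \<phi>'] by blast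
  have "0 \<le> B" by (rule order_trans[OF norm_ge_zero B[of 0]]) simp
  have F_int: "integrable (?M \<Otimes>\<^sub>M ?M) (case_prod F)"
  proof (rule P.Fubini_integrable[OF F_meas])
    have Ft: "integrable ?M (\<lambda>s. F t s)" if "t \<in> {0..1}" for t
      by (rule M.integrable_const_bound[of _ "cmod (w t) * B"])
        (use B \<open>0 \<le> B\<close> in \<open>auto simp: F_def norm_mult intro!: AE_I2 mult_left_mono\<close>)
    show "AE t in ?M. integrable ?M (\<lambda>s. case_prod F (t, s))"
      using Ft by (auto intro!: AE_I2)
    show "integrable ?M (\<lambda>t. LINT s|?M. norm (case_prod F (t, s)))"
    proof (rule Bochner_Integration.integrable_bound[where f="\<lambda>t. cmod (w t) * B * measure ?M (space ?M)"])
      show "integrable ?M (\<lambda>t. cmod (w t) * B * measure ?M (space ?M))"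
        using w by auto
      show "(\<lambda>t. LINT s|?M. norm (case_prod F (t, s))) \<in> borel_measurable ?M"
        using F_meas by measurable
      have "(LINT s|?M. norm (F t s)) \<le> (LINT s|?M. cmod (w t) * B)" if "t \<in> {0..1}" for t
        using Ft[OF that] B \<open>0 \<le> B\<close>
        by (intro integral_mono) (auto simp: F_def norm_mult intro!: mult_left_mono)
      then show "AE t in ?M. norm (LINT s|?M. norm (case_prod F (t, s)))
          \<le> norm (cmod (w t) * B * measure ?M (space ?M))"
        by (auto intro!: AE_I2 simp: \<open>0 \<le> B\<close> integral_nonneg_AE mult_ac)
    qed
  qed
  have inner_t: "(LINT s|?M. F t s) = w t * (\<phi> 1 - \<phi> t)" if t: "t \<in> {0..1}" for t
  proof -
    have eq: "F t s = (if s \<in> {t..1} then w t * \<phi>' s else 0)" if "s \<in> {0..1}" for s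
      using that t by (auto simp: F_def)
    have "(LINT s|?M. F t s) = integral {0..1} (F t)"
      by (intro lebesgue_integral_eq_integral M.integrable_const_bound[of _ "cmod (w t) * B"])
        (use B \<open>0 \<le> B\<close> in \<open>auto simp: F_def norm_mult intro!: AE_I2 mult_left_mono\<close>)
    also have "\<dots> = integral {0..1} (\<lambda>s. if s \<in> {t..1} then w t * \<phi>' s else 0)"
      by (intro integral_cong eq)
    also have "\<dots> = w t * (\<phi> 1 - \<phi> t)"
    proof (rule integral_unique, subst has_integral_restrict)
      have "(\<phi>' has_integral (\<phi> 1 - \<phi> t)) {t..1}"
        by (intro fundamental_theorem_of_calculus has_vector_derivative_within_subset[OF \<phi>])
          (use t in auto)
      then show "((\<lambda>s. w t * \<phi>' s) has_integral w t * (\<phi> 1 - \<phi> t)) {t..1}"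
        by (rule has_integral_mult_right)
    qed (use t in auto)
    finally show ?thesis .
  qed
  have inner_s: "(LINT t|?M. F t s) = \<phi>' s * (LINT t|lebesgue_on {0..s}. w t)"
    if s: "s \<in> {0..1}" for s
  proof -
    have "(LINT t|?M. F t s) = (LINT t|?M. (if t \<in> {0..s} then \<phi>' s * w t else 0))"
      by (intro Bochner_Integration.integral_cong) (auto simp: F_def)
    also have "\<dots> = (LINT t|lebesgue_on {0..s}. \<phi>' s * w t)"
      using s by (intro Lebesgue_Measure.integral_restrict) auto
    also have "\<dots> = \<phi>' s * (LINT t|lebesgue_on {0..s}. w t)"
      by simp
    finally show ?thesis .
  qed
  have \<phi>_cont: "continuous_on {0..1} \<phi>"
    unfolding continuous_on_eq_continuous_within using \<phi> has_vector_derivative_continuous by blast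
  obtain C where C: "\<And>s. s \<in> {0..1} \<Longrightarrow> cmod (\<phi> s) \<le> C"
    using continuous_on_Icc_norm_bounded[OF \<phi>_cont] by blast
  have \<phi>w: "integrable ?M (\<lambda>t. \<phi> t * w t)"
  proof (rule Bochner_Integration.integrable_bound)
    show "integrable ?M (\<lambda>t. C * cmod (w t))"
      using w by auto
    have "\<phi> \<in> borel_measurable ?M"
      using \<phi>_cont by (rule continuous_imp_measurable_on_sets_lebesgue) simp
    then show "(\<lambda>t. \<phi> t * w t) \<in> borel_measurable ?M"
      by measurable
    have "cmod (\<phi> t * w t) \<le> norm (C * cmod (w t))" if "t \<in> {0..1}" for t
      using mult_right_mono[OF C[OF that] norm_ge_zero[of "w t"]] by (simp add: norm_mult)
    then show "AE t in ?M. norm (\<phi> t * w t) \<le> norm (C * cmod (w t))"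
      by (auto intro!: AE_I2)
  qed
  have "(LINT t|?M. w t * (\<phi> 1 - \<phi> t)) = (LINT t|?M. LINT s|?M. F t s)"
    using inner_t by (intro Bochner_Integration.integral_cong) auto
  also have "\<dots> = (LINT s|?M. LINT t|?M. F t s)"
    by (rule P.Fubini_integral[OF F_int, symmetric])
  also have "\<dots> = (LINT s|?M. \<phi>' s * (LINT t|lebesgue_on {0..s}. w t))"
    using inner_s by (intro Bochner_Integration.integral_cong) auto
  also have "(LINT t|?M. w t * (\<phi> 1 - \<phi> t)) = \<phi> 1 * (LINT t|?M. w t) - (LINT t|?M. \<phi> t * w t)"
    using w \<phi>w by (simp add: algebra_simps)
  finally show ?thesis by (simp add: algebra_simps)
qed

section \<open>Linear differential equations\<close>

text \<open>Picard iteration is a contraction on all of \<open>[0,1]\<close> at once after multiplication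
  by the weight \<open>exp (- 2 L t)\<close>.\<close>

lemma volterra_equation_solvable:
  fixes F :: "real \<Rightarrow> 'a::banach \<Rightarrow> 'a" and G :: "real \<Rightarrow> 'a"
  assumes G: "continuous_on {0..1} G"
    and F: "\<And>X. continuous_on {0..1} X \<Longrightarrow> continuous_on {0..1} (\<lambda>s. F s (X s))"
    and Lip: "\<And>s x y. s \<in> {0..1} \<Longrightarrow> norm (F s x - F s y) \<le> L * norm (x - y)"
    and L: "0 < L"
  shows "\<exists>X. continuous_on {0..1} X \<and> (\<forall>t\<in>{0..1}. X t = G t + integral {0..t} (\<lambda>s. F s (X s)))"
proof -
  \<comment> \<open>Clamping to the unit interval extends continuous functions on it to bounded
    continuous functions on the line, so that the complete space of \<open>bcontfun\<close> can be
    used.\<close>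
  define c where "c t = max 0 (min 1 t)" for t :: real
  have c: "c t \<in> {0..1}" "t \<in> {0..1} \<Longrightarrow> c t = t" for t
    by (auto simp: c_def)
  have c_cont: "continuous_on UNIV c"
    unfolding c_def by (intro continuous_intros)
  \<comment> \<open>\<open>X \<phi>\<close> is the actual unknown and \<open>\<phi>\<close> its
    weighted version; the supremum norm of \<open>\<phi>\<close> is thus a weighted norm of
    \<open>X \<phi>\<close>. Accordingly \<open>S\<close> is the Picard operator followed by the
    weight.\<close>
  define X where "X \<phi> s = exp (2 * L * s) *\<^sub>R apply_bcontfun \<phi> s" for \<phi> :: "real \<Rightarrow>\<^sub>C 'a" and s
  have X_cont: "continuous_on S (X \<phi>)" for \<phi> S
    unfolding X_def by (intro continuous_intros continuous_on_apply_bcontfun)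
  define S where "S \<phi> t = exp (- 2 * L * t) *\<^sub>R (G t + integral {0..t} (\<lambda>s. F s (X \<phi> s)))" for \<phi> t
  have FX_int: "(\<lambda>s. F s (X \<phi> s)) integrable_on {0..t}" if "t \<in> {0..1}" for \<phi> t
    using that by (intro integrable_continuous_interval continuous_on_subset[OF F[OF X_cont]]) auto
  have S_cont: "continuous_on {0..1} (S \<phi>)" for \<phi>
    unfolding S_def by (intro continuous_intros G indefinite_integral_continuous_1 FX_int) simp
  have "\<exists>\<psi> :: real \<Rightarrow>\<^sub>C 'a. \<forall>t. apply_bcontfun \<psi> t = S \<phi> (c t)" for \<phi>
  proof -
    obtain B where B: "\<And>s. s \<in> {0..1} \<Longrightarrow> norm (S \<phi> s) \<le> B"
      using continuous_on_Icc_norm_bounded[OF S_cont] by blast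
    have "(\<lambda>t. S \<phi> (c t)) \<in> bcontfun"
    proof (rule bcontfun_normI)
      show "continuous_on UNIV (\<lambda>t. S \<phi> (c t))"
        by (rule continuous_on_compose2[OF S_cont c_cont]) (use c in auto)
      show "norm (S \<phi> (c t)) \<le> B" for t
        by (rule B[OF c(1)])
    qed
    then show ?thesis
      by (metis bcontfunE)
  qed
  then obtain T :: "(real \<Rightarrow>\<^sub>C 'a) \<Rightarrow> (real \<Rightarrow>\<^sub>C 'a)"
    where T: "apply_bcontfun (T \<phi>) t = S \<phi> (c t)" for \<phi> t
    by metis
  \<comment> \<open>The integral of \<open>L * exp (2 * L * s)\<close> over \<open>{0..t}\<close> is
    at most \<open>exp (2 * L * t) / 2\<close>, and the weight in \<open>S\<close> cancels the
    exponential. The factor 1/2 is therefore independent of \<open>L\<close>.\<close>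
  have contr: "dist (S \<phi> t) (S \<psi> t) \<le> 1 / 2 * dist \<phi> \<psi>" if t: "t \<in> {0..1}" for \<phi> \<psi> t
  proof -
    let ?d = "dist \<phi> \<psi>"
    let ?I = "integral {0..t} (\<lambda>s. F s (X \<phi> s) - F s (X \<psi> s))"
    have g: "((\<lambda>s. L * exp (2 * L * s) * ?d) has_integral
        (exp (2 * L * t) / 2 * ?d - exp (2 * L * 0) / 2 * ?d)) {0..t}"
      using t by (intro fundamental_theorem_of_calculus)
        (auto intro!: derivative_eq_intros simp: has_real_derivative_iff_has_vector_derivative[symmetric])
    have "norm (F s (X \<phi> s) - F s (X \<psi> s)) \<le> L * exp (2 * L * s) * ?d"
      if s: "s \<in> {0..t}" for s
    proof -
      have "norm (F s (X \<phi> s) - F s (X \<psi> s)) \<le> L * norm (X \<phi> s - X \<psi> s)"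
        using s t by (intro Lip) auto
      also have "norm (X \<phi> s - X \<psi> s) = exp (2 * L * s) * dist (apply_bcontfun \<phi> s) (apply_bcontfun \<psi> s)"
        by (simp add: X_def dist_norm flip: scaleR_diff_right)
      also have "L * \<dots> \<le> L * (exp (2 * L * s) * ?d)"
        using L by (intro mult_left_mono dist_bounded) auto
      finally show ?thesis by (simp add: mult.assoc)
    qed
    then have "norm ?I \<le> integral {0..t} (\<lambda>s. L * exp (2 * L * s) * ?d)"
      by (intro integral_norm_bound_integral integrable_diff FX_int[OF t] has_integral_integrable[OF g])
    also have "\<dots> = exp (2 * L * t) / 2 * ?d - exp (2 * L * 0) / 2 * ?d"
      by (rule integral_unique[OF g])
    also have "\<dots> \<le> exp (2 * L * t) / 2 * ?d"
      by simp
    finally have I: "norm ?I \<le> exp (2 * L * t) / 2 * ?d" .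
    have "S \<phi> t - S \<psi> t = exp (- 2 * L * t) *\<^sub>R ?I"
      using FX_int[OF t] by (simp add: S_def integral_diff flip: scaleR_diff_right)
    then have "dist (S \<phi> t) (S \<psi> t) = exp (- 2 * L * t) * norm ?I"
      by (simp add: dist_norm)
    also have "\<dots> \<le> exp (- 2 * L * t) * (exp (2 * L * t) / 2 * ?d)"
      using I by (intro mult_left_mono) auto
    also have "\<dots> = 1 / 2 * ?d"
      by (simp add: exp_minus)
    finally show ?thesis .
  qed
  have "dist (T \<phi>) (T \<psi>) \<le> 1 / 2 * dist \<phi> \<psi>" for \<phi> \<psi>
    by (rule dist_bound) (simp only: T contr[OF c(1)])
  then have "\<exists>!\<phi>. T \<phi> = \<phi>"
    by (intro banach_fix_type[of "1 / 2"]) auto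
  then obtain \<phi> where "T \<phi> = \<phi>" by blast
  then have fix': "apply_bcontfun \<phi> t = S \<phi> t" if "t \<in> {0..1}" for t
    using T[of \<phi> t] c(2)[OF that] by simp
  have "X \<phi> t = G t + integral {0..t} (\<lambda>s. F s (X \<phi> s))" if "t \<in> {0..1}" for t
  proof -
    have "X \<phi> t = exp (2 * L * t) *\<^sub>R S \<phi> t"
      by (simp add: X_def fix'[OF that])
    also have "\<dots> = (exp (2 * L * t) * exp (- 2 * L * t)) *\<^sub>R (G t + integral {0..t} (\<lambda>s. F s (X \<phi> s)))"
      by (simp add: S_def)
    also have "exp (2 * L * t) * exp (- 2 * L * t) = 1"
      by (simp flip: exp_add)
    finally show ?thesis by simp
  qed
  with X_cont show ?thesis by blast
qed

text \<open>The equation becomes a first-order system for the pair \<open>(u, v)\<close> with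
  \<open>v\<close> the derivative of \<open>u\<close>. The inhomogeneity enters through its
  primitive \<open>F\<close>, since it will only be integrable and need not be continuous.\<close>

lemma second_order_integral_equation_solvable:
  fixes W :: "real \<Rightarrow> complex" and F :: "real \<Rightarrow> complex"
  assumes W: "continuous_on {0..1} W" and F: "continuous_on {0..1} F"
  shows "\<exists>u v. continuous_on {0..1} u \<and> continuous_on {0..1} v \<and>
    (\<forall>t\<in>{0..1}. u t = a + integral {0..t} v) \<and>
    (\<forall>t\<in>{0..1}. v t = b + F t + integral {0..t} (\<lambda>s. W s * u s))"
proof -
  obtain B where B: "\<And>s. s \<in> {0..1} \<Longrightarrow> norm (W s) \<le> B"
    using continuous_on_Icc_norm_bounded[OF W] by blast
  have "0 \<le> B" by (rule order_trans[OF norm_ge_zero B[of 0]]) simp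
  define R where "R s x = (snd x, W s * fst x)" for s and x :: "complex \<times> complex"
  have "\<exists>X. continuous_on {0..1} X \<and>
      (\<forall>t\<in>{0..1}. X t = (a, b + F t) + integral {0..t} (\<lambda>s. R s (X s)))"
  \<comment> \<open>In \<open>1 + B\<close>, the 1 comes from the component \<open>snd x\<close> and
    \<open>B\<close> from the multiplication by \<open>W\<close>.\<close>
  proof (rule volterra_equation_solvable[where L="1 + B"])
    show "continuous_on {0..1} (\<lambda>t. (a, b + F t))"
      by (intro continuous_intros F)
    show "continuous_on {0..1} (\<lambda>s. R s (X s))" if "continuous_on {0..1} X" for X
      unfolding R_def by (intro continuous_intros W that)
    show "norm (R s x - R s y) \<le> (1 + B) * norm (x - y)" if "s \<in> {0..1}" for s x y
    proof -
      have "norm (R s x - R s y) = norm (snd (x - y), W s * fst (x - y))"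
        by (simp add: R_def algebra_simps)
      also have "\<dots> \<le> norm (snd (x - y)) + norm (W s) * norm (fst (x - y))"
        by (rule order_trans[OF norm_Pair_le]) (simp add: norm_mult)
      also have "\<dots> \<le> norm (x - y) + B * norm (x - y)"
        using B[OF that] \<open>0 \<le> B\<close>
          norm_fst_le[of "fst (x - y)" "snd (x - y)"] norm_snd_le[of "snd (x - y)" "fst (x - y)"]
        unfolding prod.collapse by (intro add_mono mult_mono) auto
      finally show ?thesis by (simp add: algebra_simps)
    qed
  qed (use \<open>0 \<le> B\<close> in simp)
  then obtain X where Xc: "continuous_on {0..1} X"
    and X: "\<And>t. t \<in> {0..1} \<Longrightarrow> X t = (a, b + F t) + integral {0..t} (\<lambda>s. R s (X s))"
    by blast
  have R_int: "(\<lambda>s. R s (X s)) integrable_on {0..t}" if "t \<in> {0..1}" for t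
    unfolding R_def using that
    by (intro integrable_continuous_interval continuous_intros continuous_on_subset[OF W]
        continuous_on_subset[OF Xc]) auto
  have fst_X: "fst (X t) = a + integral {0..t} (\<lambda>s. snd (X s))"
    and snd_X: "snd (X t) = b + F t + integral {0..t} (\<lambda>s. W s * fst (X s))" if t: "t \<in> {0..1}" for t
  proof -
    have "integral {0..t} (fst \<circ> (\<lambda>s. R s (X s))) = fst (integral {0..t} (\<lambda>s. R s (X s)))"
      by (rule integral_linear[OF R_int[OF t] bounded_linear_fst])
    then show "fst (X t) = a + integral {0..t} (\<lambda>s. snd (X s))"
      by (subst X[OF t]) (simp add: R_def o_def)
    have "integral {0..t} (snd \<circ> (\<lambda>s. R s (X s))) = snd (integral {0..t} (\<lambda>s. R s (X s)))"
      by (rule integral_linear[OF R_int[OF t] bounded_linear_snd])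
    then show "snd (X t) = b + F t + integral {0..t} (\<lambda>s. W s * fst (X s))"
      by (subst X[OF t]) (simp add: R_def o_def)
  qed
  show ?thesis
    by (intro exI[of _ "\<lambda>s. fst (X s)"] exI[of _ "\<lambda>s. snd (X s)"] conjI ballI
        continuous_intros Xc fst_X snd_X)
qed

section \<open>Periodic extension from the unit interval\<close>

text \<open>Glues a left and a right derivative at a point where two intervals meet.\<close>

lemma has_vector_derivative_Un:
  assumes "(f has_vector_derivative f') (at x within S)"
    and "(f has_vector_derivative f') (at x within T)"
  shows "(f has_vector_derivative f') (at x within (S \<union> T))"
  using assms Lim_Un unfolding has_vector_derivative_def has_derivative_within by blast

text \<open>On each interval between consecutive integers the extension is a translate of
  \<open>u\<close>. At an integer the one-sided derivatives are \<open>v 1\<close> and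
  \<open>v 0\<close>, which agree.\<close>

lemma periodic_extension_has_vector_derivative:
  fixes u v :: "real \<Rightarrow> 'a::real_normed_vector"
  assumes deriv: "\<And>t. t \<in> {0..1} \<Longrightarrow> (u has_vector_derivative v t) (at t within {0..1})"
    and u: "u 1 = u 0" and v: "v 1 = v 0"
  shows "((\<lambda>t. u (frac t)) has_vector_derivative v (frac t)) (at t)"
proof -
  \<comment> \<open>The closed interval includes its right end, where \<open>frac x\<close> is 0 but
    \<open>x - of_int n\<close> is 1; there the condition \<open>g 1 = g 0\<close> enters.\<close>
  have frac_eq: "g (frac x) = g (x - of_int n)"
    if "g 1 = g 0" "x \<in> {of_int n..of_int n + 1}" for g :: "real \<Rightarrow> 'a" and x and n :: int
  proof (cases "x = of_int n + 1")
    case True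
    then have "frac x = 0" by (metis frac_of_int of_int_1 of_int_add)
    with True that show ?thesis by simp
  next
    case False
    with that have "\<lfloor>x\<rfloor> = n" by (auto intro!: floor_unique)
    then show ?thesis by (simp add: frac_def)
  qed
  have within: "((\<lambda>t. u (frac t)) has_vector_derivative v (frac x))
      (at x within {of_int n..of_int n + 1})"
    if x: "x \<in> {of_int n..of_int n + 1}" for x and n :: int
  proof -
    have "((u \<circ> (\<lambda>x. x - of_int n)) has_vector_derivative 1 *\<^sub>R v (x - of_int n))
        (at x within {of_int n..of_int n + 1})"
    proof (rule vector_diff_chain_within)
      show "((\<lambda>x. x - of_int n) has_vector_derivative 1) (at x within {of_int n..of_int n + 1})"
        by (auto intro!: derivative_eq_intros)
      have img: "(\<lambda>x. x - of_int n) ` {of_int n..of_int n + 1} \<subseteq> {0..1::real}"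
        by auto
      show "(u has_vector_derivative v (x - of_int n))
          (at (x - of_int n) within (\<lambda>x. x - of_int n) ` {of_int n..of_int n + 1})"
        using x by (intro has_vector_derivative_within_subset[OF deriv img]) auto
    qed
    then have "((\<lambda>t. u (t - of_int n)) has_vector_derivative v (frac x))
        (at x within {of_int n..of_int n + 1})"
      using frac_eq[OF v x] by (simp add: o_def)
    then show ?thesis
      by (rule has_vector_derivative_transform[OF x frac_eq[OF u], rotated])
  qed
  define n where "n = \<lfloor>t\<rfloor>"
  have n: "of_int n \<le> t" "t < of_int n + 1"
    unfolding n_def by linarith+
  show ?thesis
  proof (cases "t = of_int n")
    case False
    with n have int: "t \<in> interior {of_int n..of_int n + 1}" by simp
    have "t \<in> {of_int n..of_int n + 1}" using n by simp
    from within[OF this] show ?thesis unfolding at_within_interior[OF int] .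
  next
    case True
    have "((\<lambda>t. u (frac t)) has_vector_derivative v (frac t))
        (at t within ({of_int (n - 1)..of_int (n - 1) + 1} \<union> {of_int n..of_int n + 1}))"
      by (intro has_vector_derivative_Un within) (simp_all add: True)
    moreover have "t \<in> interior ({of_int (n - 1)..of_int (n - 1) + 1} \<union> {of_int n..of_int n + 1})"
      by (rule interiorI[of "{t - 1<..<t + 1}"]) (auto simp: True)
    ultimately show ?thesis by (metis at_within_interior)
  qed
qed

section \<open>The initial value problem\<close>

text \<open>The equation \<open>u'' = W u - f\<close> on the unit interval with \<open>v\<close> for
  \<open>u'\<close>, integrated once because \<open>f\<close> is only integrable. The sign is such
  that \<open>W = V - z\<close> gives \<open>- u'' + V u - z u = f\<close>.\<close>

definition ode_solution ::
  "(real \<Rightarrow> complex) \<Rightarrow> (real \<Rightarrow> complex) \<Rightarrow> (real \<Rightarrow> complex) \<Rightarrow> (real \<Rightarrow> complex) \<Rightarrow> bool" where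
  "ode_solution W f u v \<longleftrightarrow>
     (\<forall>t\<in>{0..1}. (u has_vector_derivative v t) (at t within {0..1})) \<and> continuous_on {0..1} v \<and>
     (\<forall>t\<in>{0..1}. v t = v 0 + (LINT s|lebesgue_on {0..t}. W s * u s - f s))"

lemma ode_solutionD:
  assumes "ode_solution W f u v"
  shows "t \<in> {0..1} \<Longrightarrow> (u has_vector_derivative v t) (at t within {0..1})"
    and "continuous_on {0..1} v"
    and "t \<in> {0..1} \<Longrightarrow> v t = v 0 + (LINT s|lebesgue_on {0..t}. W s * u s - f s)"
  using assms unfolding ode_solution_def by blast+

lemma ode_solution_continuous:
  assumes "ode_solution W f u v"
  shows "continuous_on {0..1} u"
  unfolding continuous_on_eq_continuous_within
  using assms has_vector_derivative_continuous unfolding ode_solution_def by blast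

lemma ode_rhs_integrable:
  assumes "continuous_on {0..1} W" "ode_solution W f u v" "integrable unit_interval_measure f"
    and "t \<in> {0..1}"
  shows "integrable (lebesgue_on {0..t}) (\<lambda>s. W s * u s - f s)"
proof -
  have "integrable unit_interval_measure (\<lambda>s. W s * u s)"
    by (intro continuous_imp_integrable_real continuous_intros assms(1) ode_solution_continuous[OF assms(2)])
  then have "integrable unit_interval_measure (\<lambda>s. W s * u s - f s)"
    using assms(3) by (rule Bochner_Integration.integrable_diff)
  then show ?thesis
    by (rule Equivalence_Lebesgue_Henstock_Integration.integrable_subinterval) (use assms(4) in auto)
qed

text \<open>The superposition principle; repeated use yields arbitrary linear combinations.\<close>

lemma ode_solution_lincomb:
  assumes W: "continuous_on {0..1} W"
    and 1: "ode_solution W f u v" "integrable unit_interval_measure f"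
    and 2: "ode_solution W g x y" "integrable unit_interval_measure g"
  shows "ode_solution W (\<lambda>t. c * f t + g t) (\<lambda>t. c * u t + x t) (\<lambda>t. c * v t + y t)"
  unfolding ode_solution_def
proof (intro conjI ballI)
  fix t :: real assume t: "t \<in> {0..1}"
  show "((\<lambda>t. c * u t + x t) has_vector_derivative c * v t + y t) (at t within {0..1})"
    by (intro has_vector_derivative_add has_vector_derivative_mult_right
        ode_solutionD(1)[OF 1(1)] ode_solutionD(1)[OF 2(1)] t)
  have "(LINT s|lebesgue_on {0..t}. W s * (c * u s + x s) - (c * f s + g s))
      = (LINT s|lebesgue_on {0..t}. c * (W s * u s - f s) + (W s * x s - g s))"
    by (simp add: algebra_simps)
  also have "\<dots> = c * (LINT s|lebesgue_on {0..t}. W s * u s - f s)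
      + (LINT s|lebesgue_on {0..t}. W s * x s - g s)"
    using ode_rhs_integrable[OF W 1 t] ode_rhs_integrable[OF W 2 t] by simp
  finally have *: "(LINT s|lebesgue_on {0..t}. W s * (c * u s + x s) - (c * f s + g s)) = \<dots>" .
  have v: "v t = v 0 + (LINT s|lebesgue_on {0..t}. W s * u s - f s)"
    and y: "y t = y 0 + (LINT s|lebesgue_on {0..t}. W s * x s - g s)"
    by (rule ode_solutionD(3)[OF 1(1) t], rule ode_solutionD(3)[OF 2(1) t])
  show "c * v t + y t = c * v 0 + y 0
      + (LINT s|lebesgue_on {0..t}. W s * (c * u s + x s) - (c * f s + g s))"
    unfolding * using arg_cong[OF v, of "\<lambda>x. c * x"] y by (simp only: distrib_left ac_simps)
next
  show "continuous_on {0..1} (\<lambda>t. c * v t + y t)"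
    by (intro continuous_intros ode_solutionD(2)[OF 1(1)] ode_solutionD(2)[OF 2(1)])
qed

text \<open>The primitive of \<open>- f\<close> serves as the continuous inhomogeneity of the
  integral equation. What remains is to merge it with the integral of \<open>W * u\<close> into one
  Lebesgue integral.\<close>

lemma ode_solution_exists:
  assumes W: "continuous_on {0..1} W" and f: "integrable unit_interval_measure f"
  shows "\<exists>u v. ode_solution W f u v \<and> u 0 = a \<and> v 0 = b"
proof -
  let ?F = "\<lambda>t. - (LINT s|lebesgue_on {0..t}. f s)"
  have "continuous_on {0..1} ?F"
    by (intro continuous_intros indefinite_integral_continuous_real f)
  then obtain u v where uc: "continuous_on {0..1} u" and vc: "continuous_on {0..1} v"
    and u: "\<And>t. t \<in> {0..1} \<Longrightarrow> u t = a + integral {0..t} v"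
    and v: "\<And>t. t \<in> {0..1} \<Longrightarrow> v t = b + ?F t + integral {0..t} (\<lambda>s. W s * u s)"
    using second_order_integral_equation_solvable[OF W, of ?F a b] by blast
  have sub: "integrable (lebesgue_on {0..t}) g"
    if "integrable unit_interval_measure g" "t \<in> {0..1}" for t and g :: "real \<Rightarrow> complex"
    by (rule Equivalence_Lebesgue_Henstock_Integration.integrable_subinterval[OF that(1)])
      (use that(2) in auto)
  have Wu: "integrable unit_interval_measure (\<lambda>s. W s * u s)"
    by (intro continuous_imp_integrable_real continuous_intros W uc)
  have v': "v t = b + (LINT s|lebesgue_on {0..t}. W s * u s - f s)" if t: "t \<in> {0..1}" for t
    using sub[OF f t] sub[OF Wu t] by (simp add: v[OF t] lebesgue_integral_eq_integral)
  have v0: "v 0 = b"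
    using v'[of 0] sub[OF Wu, of 0] sub[OF f, of 0] by (simp add: lebesgue_integral_eq_integral)
  have "ode_solution W f u v"
    unfolding ode_solution_def
  proof (intro conjI ballI vc)
    fix t :: real assume t: "t \<in> {0..1}"
    have "((\<lambda>t. a + integral {0..t} v) has_vector_derivative 0 + v t) (at t within {0..1})"
      by (intro has_vector_derivative_add has_vector_derivative_const
          integral_has_vector_derivative vc t)
    then show "(u has_vector_derivative v t) (at t within {0..1})"
      using has_vector_derivative_transform[OF t u] by simp
    show "v t = v 0 + (LINT s|lebesgue_on {0..t}. W s * u s - f s)"
      using v'[OF t] v0 by simp
  qed
  moreover have "u 0 = a" using u[of 0] by simp
  ultimately show ?thesis using v0 by blast
qed

section \<open>Schroedinger operators with continuous potential\<close>

text \<open>The form of \<open>H_op\<close> with a general real potential, so that the resolvent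
  argument depends only on continuity of \<open>V\<close> and on coercivity.\<close>

definition schroedinger :: "(real \<Rightarrow> real) \<Rightarrow> L2_operator" where
  "schroedinger V = {(u, v). v \<in> L2_unit \<and>
     (\<exists>w. periodic_H2 u w \<and> L2_eq v (\<lambda>t. - w t + complex_of_real (V t) * u t))}"

lemma periodic_H2D:
  assumes "periodic_H2 u w" and u': "\<And>t. (u has_vector_derivative u' t) (at t)"
  shows "t \<in> {0..1} \<Longrightarrow> u' t = u' 0 + (LINT s|lebesgue_on {0..t}. w s)"
    and "u 1 = u 0" and "u' 1 = u' 0" and "continuous_on {0..1} u'" and "w \<in> L2_unit"
proof -
  from assms(1) obtain d where d: "\<And>t. (u has_vector_derivative d t) (at t)"
    and int: "\<And>t. t \<in> {0..1} \<Longrightarrow> d t = d 0 + (LINT s|lebesgue_on {0..t}. w s)"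
    and per: "\<And>t. u (t + 1) = u t" and w: "w \<in> L2_unit"
    unfolding periodic_H2_def periodic1_def by blast
  \<comment> \<open>The definition only asserts that some derivative exists; uniqueness of
    derivatives identifies it with the given one.\<close>
  have "d = u'"
    using d u' vector_derivative_unique_at by blast
  note int = int[unfolded this]
  show "t \<in> {0..1} \<Longrightarrow> u' t = u' 0 + (LINT s|lebesgue_on {0..t}. w s)" and "w \<in> L2_unit"
    by (fact int w)+
  \<comment> \<open>Differentiating \<open>u (t + 1) = u t\<close> at 0 transfers periodicity to the
    derivative.\<close>
  have "((u \<circ> (\<lambda>t. t + 1)) has_vector_derivative 1 *\<^sub>R u' (0 + 1)) (at 0)"
    by (rule vector_diff_chain_at) (auto intro!: derivative_eq_intros u')
  then have "(u has_vector_derivative u' 1) (at 0)"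
    by (simp add: o_def per)
  then show "u' 1 = u' 0"
    using u' vector_derivative_unique_at by blast
  have "continuous_on {0..1} (\<lambda>t. u' 0 + (LINT s|lebesgue_on {0..t}. w s))"
    by (intro continuous_intros indefinite_integral_continuous_real L2_unit_integrable w)
  then show "continuous_on {0..1} u'"
    by (rule continuous_on_eq) (simp add: int[symmetric])
  show "u 1 = u 0" using per[of 0] by simp
qed

lemma periodic_H2_continuous:
  assumes "periodic_H2 u w"
  shows "continuous_on S u"
proof -
  obtain u' where "\<And>t. (u has_vector_derivative u' t) (at t)"
    using assms unfolding periodic_H2_def by blast
  then show ?thesis
    by (intro continuous_at_imp_continuous_on ballI has_vector_derivative_continuous)
qed

lemma periodic_H2_diff:
  assumes "periodic_H2 u w" "periodic_H2 x y"
  shows "periodic_H2 (\<lambda>t. u t - x t) (\<lambda>t. w t - y t)"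
proof -
  obtain u' where u: "\<And>t. (u has_vector_derivative u' t) (at t)"
    "\<And>t. t \<in> {0..1} \<Longrightarrow> u' t = u' 0 + (LINT s|lebesgue_on {0..t}. w s)" "w \<in> L2_unit"
    using assms(1) unfolding periodic_H2_def by blast
  obtain x' where x: "\<And>t. (x has_vector_derivative x' t) (at t)"
    "\<And>t. t \<in> {0..1} \<Longrightarrow> x' t = x' 0 + (LINT s|lebesgue_on {0..t}. y s)" "y \<in> L2_unit"
    using assms(2) unfolding periodic_H2_def by blast
  have "u' t - x' t = u' 0 - x' 0 + (LINT s|lebesgue_on {0..t}. w s - y s)"
    if t: "t \<in> {0..1}" for t
  proof -
    have sub: "integrable (lebesgue_on {0..t}) g" if "g \<in> L2_unit" for g
      by (rule Equivalence_Lebesgue_Henstock_Integration.integrable_subinterval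
          [OF L2_unit_integrable[OF that]]) (use t in auto)
    have "(LINT s|lebesgue_on {0..t}. w s - y s)
        = (LINT s|lebesgue_on {0..t}. w s) - (LINT s|lebesgue_on {0..t}. y s)"
      by (intro Bochner_Integration.integral_diff sub u x)
    then show ?thesis
      by (simp only: u(2)[OF t] x(2)[OF t] add_diff_add)
  qed
  moreover have "((\<lambda>t. u t - x t) has_vector_derivative u' t - x' t) (at t)" for t
    by (intro has_vector_derivative_diff u x)
  ultimately have "\<exists>d. (\<forall>t. ((\<lambda>t. u t - x t) has_vector_derivative d t) (at t)) \<and>
      (\<forall>t\<in>{0..1}. d t = d 0 + (LINT s|lebesgue_on {0..t}. w s - y s))"
    by (intro exI[of _ "\<lambda>t. u' t - x' t"]) blast
  moreover have "periodic1 (\<lambda>t. u t - x t)"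
    using assms by (simp add: periodic_H2_def periodic1_def)
  ultimately show ?thesis
    unfolding periodic_H2_def using L2_unit_diff[OF u(3) x(3)] by blast
qed

lemma schroedinger_diff:
  assumes "(u, v) \<in> schroedinger V" "(x, y) \<in> schroedinger V"
  shows "(\<lambda>t. u t - x t, \<lambda>t. v t - y t) \<in> schroedinger V"
proof -
  from assms obtain w z where v: "v \<in> L2_unit" "periodic_H2 u w"
      "AE t in unit_interval_measure. v t = - w t + complex_of_real (V t) * u t"
    and y: "y \<in> L2_unit" "periodic_H2 x z"
      "AE t in unit_interval_measure. y t = - z t + complex_of_real (V t) * x t"
    unfolding schroedinger_def L2_eq_def by blast
  have "AE t in unit_interval_measure.
      v t - y t = - (w t - z t) + complex_of_real (V t) * (u t - x t)"
    using v(3) y(3)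
  proof eventually_elim
    case (elim t)
    show ?case unfolding elim by (simp add: algebra_simps)
  qed
  with L2_unit_diff[OF v(1) y(1)] periodic_H2_diff[OF v(2) y(2)] show ?thesis
    unfolding schroedinger_def L2_eq_def by blast
qed

lemma schroedinger_domain_continuous:
  "(u, v) \<in> schroedinger V \<Longrightarrow> continuous_on S u"
  unfolding schroedinger_def using periodic_H2_continuous by blast

lemma schroedinger_in_L2_unit:
  assumes "(u, v) \<in> schroedinger V"
  shows "u \<in> L2_unit" "v \<in> L2_unit"
  using assms continuous_in_L2_unit[OF schroedinger_domain_continuous[OF assms]]
  by (auto simp: schroedinger_def)

lemma frac_unit_interval:
  assumes "u 1 = u 0" "t \<in> {0..1::real}"
  shows "u (frac t) = u t"
proof -
  have "t = 1 \<or> frac t = t" using assms(2) by (auto simp: frac_eq)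
  then show ?thesis using assms(1) by auto
qed

text \<open>Matching boundary data make the periodic extension of \<open>u\<close> an element of the
  domain. Its image is \<open>z * u + f\<close> by the equation, so \<open>T - z\<close> maps it to
  \<open>f\<close>.\<close>

lemma periodic_ode_solution_in_schroedinger:
  assumes V: "continuous_on {0..1} V" and f: "f \<in> L2_unit"
    and sol: "ode_solution (\<lambda>t. complex_of_real (V t) - z) f u v"
    and u1: "u 1 = u 0" and v1: "v 1 = v 0"
  shows "(\<lambda>t. u (frac t), \<lambda>t. z * u (frac t) + f t) \<in> schroedinger V"
proof -
  have frac: "u (frac t) = u t" "v (frac t) = v t" if "t \<in> {0..1}" for t
    using that by (simp_all only: frac_unit_interval u1 v1)
  \<comment> \<open>The second derivative prescribed by the equation. Only its values on the unit
    interval matter, so \<open>V\<close> and \<open>f\<close> are taken at \<open>t\<close>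
    itself.\<close>
  define w where "w t = (complex_of_real (V t) - z) * u (frac t) - f t" for t
  have uc: "continuous_on {0..1} (\<lambda>t. u (frac t))"
    by (rule continuous_on_eq[OF ode_solution_continuous[OF sol]]) (simp add: frac)
  have w: "w \<in> L2_unit"
    unfolding w_def by (intro L2_unit_diff f continuous_in_L2_unit continuous_intros V uc)
  have "periodic_H2 (\<lambda>t. u (frac t)) w"
    unfolding periodic_H2_def
  proof (intro conjI exI[of _ "\<lambda>t. v (frac t)"] allI ballI w)
    show "periodic1 (\<lambda>t. u (frac t))"
      by (simp add: periodic1_def frac_1_eq)
    show "((\<lambda>t. u (frac t)) has_vector_derivative v (frac t)) (at t)" for t
      by (rule periodic_extension_has_vector_derivative[OF ode_solutionD(1)[OF sol] u1 v1])
    show "v (frac t) = v (frac 0) + (LINT s|lebesgue_on {0..t}. w s)" if t: "t \<in> {0..1}" for t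
    proof -
      have "(LINT s|lebesgue_on {0..t}. w s)
          = (LINT s|lebesgue_on {0..t}. (complex_of_real (V s) - z) * u s - f s)"
        using t by (intro Bochner_Integration.integral_cong) (auto simp: w_def frac)
      moreover have "v (frac 0) = v 0"
        by (rule frac(2)) simp
      ultimately show ?thesis
        using ode_solutionD(3)[OF sol t] frac(2)[OF t] by (simp only:)
    qed
  qed
  moreover have "(\<lambda>t. z * u (frac t) + f t) = (\<lambda>t. - w t + complex_of_real (V t) * u (frac t))"
    by (auto simp: w_def algebra_simps)
  moreover have "(\<lambda>t. z * u (frac t) + f t) \<in> L2_unit"
    by (intro L2_unit_add L2_unit_cmult f continuous_in_L2_unit uc)
  ultimately show ?thesis
    unfolding schroedinger_def using L2_eq_refl by auto
qed

section \<open>The Fredholm alternative\<close>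

text \<open>A non-negative continuous function with integral zero vanishes at every point. This
  turns a statement about norms into one about initial data.\<close>

lemma continuous_L2_norm_0_imp:
  assumes "continuous_on {0..1} u" "L2_norm u = 0" "t \<in> {0..1}"
  shows "u t = 0"
proof -
  have c: "continuous_on {0..1} (\<lambda>t. (cmod (u t))\<^sup>2)"
    by (intro continuous_intros assms)
  have "(LINT t|unit_interval_measure. (cmod (u t))\<^sup>2) = 0"
    using assms(2) by (simp flip: L2_norm_power2)
  then have "integral {0..1} (\<lambda>t. (cmod (u t))\<^sup>2) = 0"
    using lebesgue_integral_eq_integral[OF continuous_imp_integrable_real[OF c]] by simp
  then have "((\<lambda>t. (cmod (u t))\<^sup>2) has_integral 0) (cbox 0 1)"
    using integrable_integral[OF integrable_continuous_interval[OF c]] by simp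
  then have "(cmod (u t))\<^sup>2 = 0"
    by (rule has_integral_0_cbox_imp_0[rotated 2]) (use c assms(3) in auto)
  then show ?thesis by simp
qed

text \<open>Coercivity excludes nontrivial periodic solutions of the homogeneous equation; hence the
  (linear) defect of periodicity of the initial data is injective on a finite-dimensional space,
  and so the defect of any particular solution can be compensated.\<close>

lemma resolvent_set_of_coercive:
  assumes V: "continuous_on {0..1} V" and d: "0 < d"
    and coercive: "\<And>u v. (u, v) \<in> schroedinger V \<Longrightarrow>
      d * (L2_norm u)\<^sup>2 \<le> cmod (LINT t|unit_interval_measure. cnj (u t) * (v t - z * u t))"
  shows "z \<in> resolvent_set (schroedinger V)"
proof -
  let ?W = "\<lambda>t. complex_of_real (V t) - z"
  have W: "continuous_on {0..1} ?W"
    by (intro continuous_intros V)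
  have zero: "integrable unit_interval_measure (\<lambda>_. 0 :: complex)" "(\<lambda>_. 0) \<in> L2_unit"
    by (simp_all add: L2_unit_def)
  have bound: "L2_norm u \<le> 1 / d * L2_norm (\<lambda>t. v t - z * u t)"
    if uv: "(u, v) \<in> schroedinger V" for u v
    using schroedinger_in_L2_unit[OF uv] coercive[OF uv] d
    by (intro L2_norm_bound_of_coercive L2_unit_diff L2_unit_cmult)
  \<comment> \<open>The extension of such a solution lies in the kernel of \<open>T - z\<close>, so
    the bound makes its norm zero. Then \<open>u\<close> vanishes on the whole interval, and
    \<open>v 0\<close> is the one-sided derivative at 0 of the zero function.\<close>
  have no_kernel: "u 0 = 0 \<and> v 0 = 0"
    if sol: "ode_solution ?W (\<lambda>_. 0) u v" and per: "u 1 = u 0" "v 1 = v 0" for u v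
  proof -
    have "(\<lambda>t. u (frac t), \<lambda>t. z * u (frac t) + 0) \<in> schroedinger V"
      by (rule periodic_ode_solution_in_schroedinger[OF V zero(2) sol per])
    from bound[OF this] schroedinger_domain_continuous[OF this]
    have "L2_norm (\<lambda>t. u (frac t)) = 0" and c: "continuous_on {0..1} (\<lambda>t. u (frac t))"
      using L2_norm_nonneg[of "\<lambda>t. u (frac t)"] by (simp_all add: L2_norm_zero)
    then have u0: "u t = 0" if "t \<in> {0..1}" for t
      using continuous_L2_norm_0_imp[OF c _ that] frac_unit_interval[of u, OF per(1) that] by simp
    have "(u has_vector_derivative v 0) (at 0 within cbox 0 1)"
      using ode_solutionD(1)[OF sol, of 0] by simp
    moreover have "(u has_vector_derivative 0) (at 0 within cbox 0 1)"
      by (rule has_vector_derivative_transform[where f="\<lambda>_. 0"]) (simp_all add: u0)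
    ultimately have "v 0 = 0"
      by (intro vector_derivative_unique_within_closed_interval[of 0 1 0 u]) simp_all
    with u0 show ?thesis by simp
  qed
  obtain u1 v1 where 1: "ode_solution ?W (\<lambda>_. 0) u1 v1" "u1 0 = 1" "v1 0 = 0"
    using ode_solution_exists[OF W zero(1)] by blast
  obtain u2 v2 where 2: "ode_solution ?W (\<lambda>_. 0) u2 v2" "u2 0 = 0" "v2 0 = 1"
    using ode_solution_exists[OF W zero(1)] by blast
  \<comment> \<open>For the homogeneous solution with initial data \<open>(a, b)\<close>,
    \<open>D\<close> returns the defect of periodicity: the value and derivative at 1 minus those at
    0.\<close>
  define D where "D = (\<lambda>(a, b). (a * (u1 1 - 1) + b * u2 1, a * v1 1 + b * (v2 1 - 1)))"
  have D_linear: "linear D"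
    by (rule linearI) (auto simp: D_def algebra_simps)
  have "x = 0" if "D x = 0" for x
  proof -
    obtain a b where x: "x = (a, b)" by force
    \<comment> \<open>The superposition lemma scales only its first solution, so the zero solution
      is taken as the second.\<close>
    have "ode_solution ?W (\<lambda>t. b * 0 + 0) (\<lambda>t. b * u2 t + 0) (\<lambda>t. b * v2 t + 0)"
      by (intro ode_solution_lincomb W 2 zero) (simp add: ode_solution_def)
    then have "ode_solution ?W (\<lambda>t. a * 0 + 0) (\<lambda>t. a * u1 t + b * u2 t) (\<lambda>t. a * v1 t + b * v2 t)"
      by (intro ode_solution_lincomb W 1 zero) simp
    then have "a * u1 0 + b * u2 0 = 0 \<and> a * v1 0 + b * v2 0 = 0"
      using that by (intro no_kernel) (auto simp: D_def x 1 2 algebra_simps zero_prod_def)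
    then show ?thesis by (simp add: x 1 2 zero_prod_def)
  qed
  then have "inj D"
    using linear_injective_0[OF D_linear] by blast
  \<comment> \<open>\<open>D\<close> is regarded as a real-linear endomorphism of the
    finite-dimensional real space of pairs of complex numbers.\<close>
  then have "surj D"
    using D_linear by (simp add: linear_injective_imp_surjective)
  have exists: "\<exists>(u, v)\<in>schroedinger V. L2_eq (\<lambda>t. v t - z * u t) f" if f: "f \<in> L2_unit" for f
  proof -
    have f_int: "integrable unit_interval_measure f"
      by (rule L2_unit_integrable[OF f])
    \<comment> \<open>With zero initial data the defect of the particular solution is
      \<open>(u3 1, v3 1)\<close>; \<open>a\<close> and \<open>b\<close> are chosen to cancel
      it.\<close>
    obtain u3 v3 where 3: "ode_solution ?W f u3 v3" "u3 0 = 0" "v3 0 = 0"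
      using ode_solution_exists[OF W f_int] by blast
    obtain a b where "D (a, b) = (- u3 1, - v3 1)"
      using \<open>surj D\<close> by (metis surjD surj_pair)
    then have ab: "a * u1 1 + b * u2 1 + u3 1 = a" "a * v1 1 + b * v2 1 + v3 1 = b"
      by (auto simp: D_def algebra_simps eq_neg_iff_add_eq_0)
    have "ode_solution ?W (\<lambda>t. b * 0 + f t) (\<lambda>t. b * u2 t + u3 t) (\<lambda>t. b * v2 t + v3 t)"
      by (intro ode_solution_lincomb W 2 3 zero f_int)
    then have "ode_solution ?W (\<lambda>t. a * 0 + f t)
        (\<lambda>t. a * u1 t + (b * u2 t + u3 t)) (\<lambda>t. a * v1 t + (b * v2 t + v3 t))"
      by (intro ode_solution_lincomb W 1 zero f_int) simp
    then have sol: "ode_solution ?W f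
        (\<lambda>t. a * u1 t + (b * u2 t + u3 t)) (\<lambda>t. a * v1 t + (b * v2 t + v3 t))"
      by simp
    have "(\<lambda>t. a * u1 (frac t) + (b * u2 (frac t) + u3 (frac t)),
        \<lambda>t. z * (a * u1 (frac t) + (b * u2 (frac t) + u3 (frac t))) + f t) \<in> schroedinger V"
      by (rule periodic_ode_solution_in_schroedinger[OF V f sol])
        (simp_all add: 1 2 3 ab flip: add.assoc)
    then show ?thesis
      by (rule rev_bexI) (simp add: L2_eq_refl)
  qed
  have unique: "L2_eq u x"
    if uv: "(u, v) \<in> schroedinger V" and xy: "(x, y) \<in> schroedinger V"
      and eq: "L2_eq (\<lambda>t. v t - z * u t) (\<lambda>t. y t - z * x t)" for u v x y
  proof -
    \<comment> \<open>By linearity the difference of the two pairs is in the graph, and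
      \<open>T - z\<close> maps it to zero almost everywhere; the bound then makes its norm
      zero.\<close>
    note diff = schroedinger_diff[OF uv xy]
    have "L2_eq (\<lambda>t. v t - y t - z * (u t - x t)) (\<lambda>_. 0)"
      using eq unfolding L2_eq_def by eventually_elim (simp add: algebra_simps)
    moreover have "(\<lambda>t. v t - y t - z * (u t - x t)) \<in> L2_unit"
      by (intro L2_unit_diff L2_unit_cmult schroedinger_in_L2_unit[OF uv]
          schroedinger_in_L2_unit[OF xy])
    ultimately have "L2_norm (\<lambda>t. v t - y t - z * (u t - x t)) = L2_norm (\<lambda>_. 0)"
      by (intro L2_norm_cong zero)
    with bound[OF diff] have "L2_norm (\<lambda>t. u t - x t) = 0"
      using L2_norm_nonneg[of "\<lambda>t. u t - x t"] by (simp add: L2_norm_zero)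
    then have "L2_eq (\<lambda>t. u t - x t) (\<lambda>_. 0)"
      by (intro L2_norm_eq_0_imp schroedinger_in_L2_unit[OF diff])
    then show ?thesis
      unfolding L2_eq_def by eventually_elim simp
  qed
  have "\<exists>C. \<forall>(u, v)\<in>schroedinger V. L2_norm u \<le> C * L2_norm (\<lambda>t. v t - z * u t)"
    using bound by (intro exI[of _ "1 / d"]) auto
  then show ?thesis
    unfolding resolvent_set_def using exists unique by auto
qed

section \<open>Energy estimates\<close>

text \<open>Parts with \<open>cnj u\<close> as the smooth factor. Periodicity is used twice:
  \<open>w\<close> has mean zero because \<open>u' 1 = u' 0\<close>, and \<open>cnj u'\<close> has
  mean zero because \<open>u 1 = u 0\<close>, which removes the constant \<open>u' 0\<close> in the
  primitive of \<open>w\<close>.\<close>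

lemma integral_cnj_second_derivative:
  assumes u: "periodic_H2 u w" and u': "\<And>t. (u has_vector_derivative u' t) (at t)"
  shows "(LINT t|unit_interval_measure. cnj (u t) * w t)
    = - (LINT t|unit_interval_measure. cnj (u' t) * u' t)"
proof -
  let ?M = unit_interval_measure
  note int = periodic_H2D(1)[OF u u'] and u1 = periodic_H2D(2)[OF u u']
    and u'1 = periodic_H2D(3)[OF u u'] and u'_cont = periodic_H2D(4)[OF u u']
    and w = periodic_H2D(5)[OF u u']
  have cu': "continuous_on {0..1} (\<lambda>t. cnj (u' t))"
    by (intro continuous_intros u'_cont)
  have "(LINT t|lebesgue_on {0..1}. w t) = 0"
    using int[of 1] u'1 by simp
  then have "(LINT t|?M. cnj (u t) * w t)
      = - (LINT s|?M. cnj (u' s) * (LINT t|lebesgue_on {0..s}. w t))"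
    using integral_by_parts_primitive[OF L2_unit_integrable[OF w] has_vector_derivative_cnj
        [OF has_vector_derivative_at_within[OF u']] cu'] by simp
  also have "(LINT s|?M. cnj (u' s) * (LINT t|lebesgue_on {0..s}. w t))
      = (LINT s|?M. cnj (u' s) * u' s - u' 0 * cnj (u' s))"
  proof (intro Bochner_Integration.integral_cong)
    fix s assume "s \<in> space ?M"
    then have W: "(LINT t|lebesgue_on {0..s}. w t) = u' s - u' 0"
      using int[of s] by simp
    show "cnj (u' s) * (LINT t|lebesgue_on {0..s}. w t) = cnj (u' s) * u' s - u' 0 * cnj (u' s)"
      unfolding W by (simp add: algebra_simps)
  qed simp
  also have "\<dots> = (LINT s|?M. cnj (u' s) * u' s) - u' 0 * (LINT s|?M. cnj (u' s))"
    using continuous_imp_integrable_real[OF cu']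
      continuous_imp_integrable_real[OF continuous_on_mult[OF cu' u'_cont]] by simp
  also have "(LINT s|?M. cnj (u' s)) = 0"
  proof -
    have "((\<lambda>t. cnj (u' t)) has_integral cnj (u 1) - cnj (u 0)) {0..1}"
      by (intro fundamental_theorem_of_calculus has_vector_derivative_cnj
          has_vector_derivative_at_within[OF u']) simp
    then show ?thesis
      using lebesgue_integral_eq_integral[OF continuous_imp_integrable_real[OF cu']]
      by (simp add: u1 integral_unique)
  qed
  finally show ?thesis by simp
qed

text \<open>With \<open>B = - d/dt + p\<close>, one has \<open>B\<^sup>* B = - d\<^sup>2/dt\<^sup>2 + p\<^sup>2 + p'\<close>.\<close>

lemma schroedinger_energy_identity:
  fixes p p' :: "real \<Rightarrow> real" and u u' :: "real \<Rightarrow> complex"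
  assumes p: "\<And>t. t \<in> {0..1} \<Longrightarrow> (p has_real_derivative p' t) (at t within {0..1})"
    and p': "continuous_on {0..1} p'" and p1: "p 1 = p 0"
    and V: "\<And>t. t \<in> {0..1} \<Longrightarrow> V t = (p t)\<^sup>2 + p' t"
    and uv: "(u, v) \<in> schroedinger V" and u': "\<And>t. (u has_vector_derivative u' t) (at t)"
  shows "(LINT t|unit_interval_measure. cnj (u t) * v t)
    = complex_of_real ((L2_norm (\<lambda>t. u' t - p t * u t))\<^sup>2)"
proof -
  let ?M = unit_interval_measure
  obtain w where uw: "periodic_H2 u w" and v: "v \<in> L2_unit"
    and v_eq: "AE t in ?M. v t = - w t + complex_of_real (V t) * u t"
    using uv unfolding schroedinger_def L2_eq_def by blast
  note u1 = periodic_H2D(2)[OF uw u'] and u'_cont = periodic_H2D(4)[OF uw u']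
    and w = periodic_H2D(5)[OF uw u']
  have u_cont: "continuous_on {0..1} u"
    by (rule periodic_H2_continuous[OF uw])
  have p_cont: "continuous_on {0..1} p"
    by (rule DERIV_continuous_on[OF p])
  \<comment> \<open>This is \<open>- B u\<close>, which has the same norm as
    \<open>B u\<close>.\<close>
  define y where "y t = u' t - p t * u t" for t
  have y_cont: "continuous_on {0..1} y"
    unfolding y_def by (intro continuous_intros u_cont u'_cont p_cont)
  \<comment> \<open>The derivative of \<open>p * cnj u * u\<close>, which is the difference between
    the integrand of the form and the squared modulus of \<open>y\<close>. Its integral vanishes
    since \<open>p\<close> and \<open>u\<close> take equal values at both ends.\<close>
  define g' where "g' t = p t * (cnj (u t) * u' t + cnj (u' t) * u t) + p' t * (cnj (u t) * u t)" for t
  have g'_cont: "continuous_on {0..1} g'"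
    unfolding g'_def by (intro continuous_intros u_cont u'_cont p_cont p')
  have "(g' has_integral p 1 * (cnj (u 1) * u 1) - p 0 * (cnj (u 0) * u 0)) {0..1}"
  proof (rule fundamental_theorem_of_calculus)
    fix t :: real assume t: "t \<in> {0..1}"
    show "((\<lambda>t. p t * (cnj (u t) * u t)) has_vector_derivative g' t) (at t within {0..1})"
      unfolding g'_def
      by (intro has_vector_derivative_mult has_vector_derivative_of_real p t
          has_vector_derivative_cnj has_vector_derivative_at_within[OF u'])
  qed simp
  then have g'_int: "(LINT t|?M. g' t) = 0"
    using lebesgue_integral_eq_integral[OF continuous_imp_integrable_real[OF g'_cont]]
    by (simp add: u1 p1 integral_unique)
  have Vc: "continuous_on {0..1} (\<lambda>t. complex_of_real ((p t)\<^sup>2 + p' t) * (cnj (u t) * u t))"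
    by (intro continuous_intros u_cont p_cont p')
  have cuw: "integrable ?M (\<lambda>t. cnj (u t) * w t)"
    by (intro L2_unit_mult_integrable L2_unit_cnj w continuous_in_L2_unit u_cont)
  have "(LINT t|?M. cnj (u t) * v t)
      = (LINT t|?M. complex_of_real ((p t)\<^sup>2 + p' t) * (cnj (u t) * u t) - cnj (u t) * w t)"
  proof (rule integral_cong_AE)
    show "(\<lambda>t. cnj (u t) * v t) \<in> borel_measurable ?M"
      by (intro borel_measurable_integrable L2_unit_mult_integrable L2_unit_cnj v
          continuous_in_L2_unit u_cont)
    show "(\<lambda>t. complex_of_real ((p t)\<^sup>2 + p' t) * (cnj (u t) * u t) - cnj (u t) * w t)
        \<in> borel_measurable ?M"
      by (intro borel_measurable_integrable Bochner_Integration.integrable_diff cuw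
          continuous_imp_integrable_real Vc)
    show "AE t in ?M. cnj (u t) * v t
        = complex_of_real ((p t)\<^sup>2 + p' t) * (cnj (u t) * u t) - cnj (u t) * w t"
      using v_eq AE_space
    proof eventually_elim
      case (elim t)
      then have t: "t \<in> {0..1}" by simp
      show ?case unfolding elim(1) V[OF t] by (simp add: algebra_simps)
    qed
  qed
  also have "\<dots> = (LINT t|?M. complex_of_real ((p t)\<^sup>2 + p' t) * (cnj (u t) * u t))
      + (LINT t|?M. cnj (u' t) * u' t)"
    using integral_cnj_second_derivative[OF uw u']
      Bochner_Integration.integral_diff[OF continuous_imp_integrable_real[OF Vc] cuw] by simp
  also have "\<dots> = (LINT t|?M. complex_of_real ((p t)\<^sup>2 + p' t) * (cnj (u t) * u t) + cnj (u' t) * u' t)"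
    by (intro Bochner_Integration.integral_add[symmetric] continuous_imp_integrable_real
        Vc continuous_intros u'_cont)
  also have "\<dots> = (LINT t|?M. cnj (y t) * y t + g' t)"
    by (intro Bochner_Integration.integral_cong)
      (simp_all add: y_def g'_def algebra_simps power2_eq_square)
  also have "\<dots> = (LINT t|?M. cnj (y t) * y t)"
    using g'_int continuous_imp_integrable_real[OF g'_cont]
      continuous_imp_integrable_real[OF continuous_on_mult[OF continuous_on_cnj[OF y_cont] y_cont]]
    by simp
  also have "\<dots> = (LINT t|?M. complex_of_real ((cmod (y t))\<^sup>2))"
    by (simp only: complex_norm_square mult.commute)
  also have "\<dots> = complex_of_real ((L2_norm y)\<^sup>2)"
    unfolding L2_norm_power2 by (rule integral_complex_of_real)
  finally show ?thesis unfolding y_def .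
qed

section \<open>Lower bounds for the quadratic form\<close>

text \<open>\<open>E\<close> stands for the squared norm of \<open>B u\<close> and \<open>N\<close>
  for that of \<open>u\<close>. For negative real \<open>z\<close> the real part gives
  \<open>d = - Re z\<close>; otherwise \<open>E\<close> drops out of the imaginary part and
  \<open>d = \<bar>Im z\<bar>\<close> works, though it may be smaller than the actual
  distance.\<close>

lemma distance_to_nonneg_reals:
  fixes z :: complex
  assumes "z \<notin> complex_of_real ` {0..}"
  shows "\<exists>d>0. \<forall>E N. 0 \<le> E \<longrightarrow> 0 \<le> N \<longrightarrow> d * N \<le> cmod (complex_of_real E - z * complex_of_real N)"
proof (cases "Im z = 0")
  case True
  then have z: "z = complex_of_real (Re z)" by (simp add: complex_eq_iff)
  with assms have neg: "Re z < 0" by force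
  have "- Re z * N \<le> cmod (complex_of_real E - z * complex_of_real N)" if "0 \<le> E" "0 \<le> N" for E N
  proof -
    have "- Re z * N \<le> Re (complex_of_real E - z * complex_of_real N)"
      using that by simp
    then show ?thesis using complex_Re_le_cmod order_trans by blast
  qed
  with neg show ?thesis by (intro exI[of _ "- Re z"]) auto
next
  case False
  have "\<bar>Im z\<bar> * N \<le> cmod (complex_of_real E - z * complex_of_real N)" if "0 \<le> E" "0 \<le> N" for E N
    using abs_Im_le_cmod[of "complex_of_real E - z * complex_of_real N"] that
    by (simp add: abs_mult)
  with False show ?thesis by (intro exI[of _ "\<bar>Im z\<bar>"]) auto
qed

text \<open>The variance of \<open>f\<close> is non-negative, the interval having length
  one.\<close>

lemma integral_power2_le_integral_of_power2:
  fixes f :: "real \<Rightarrow> real"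
  assumes f: "continuous_on {0..1} f"
  shows "(integral {0..1} f)\<^sup>2 \<le> integral {0..1} (\<lambda>t. (f t)\<^sup>2)"
proof -
  let ?Y = "integral {0..1} f"
  have int: "f integrable_on {0..1}" "(\<lambda>t. (f t)\<^sup>2) integrable_on {0..1}"
    by (intro integrable_continuous_interval continuous_intros f)+
  have "0 \<le> integral {0..1} (\<lambda>t. (f t - ?Y)\<^sup>2)"
    by (intro Henstock_Kurzweil_Integration.integral_nonneg integrable_continuous_interval
        continuous_intros f) simp
  also have "(\<lambda>t. (f t - ?Y)\<^sup>2) = (\<lambda>t. (f t)\<^sup>2 - 2 * ?Y * f t + ?Y\<^sup>2)"
    by (simp add: power2_diff algebra_simps)
  also have "integral {0..1} \<dots> = integral {0..1} (\<lambda>t. (f t)\<^sup>2) - 2 * ?Y * ?Y + ?Y\<^sup>2"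
  proof (rule integral_unique)
    have "((\<lambda>t::real. ?Y\<^sup>2) has_integral ?Y\<^sup>2) {0..1}"
      using has_integral_const_real[of "?Y\<^sup>2" 0 1] by simp
    then show "((\<lambda>t. (f t)\<^sup>2 - 2 * ?Y * f t + ?Y\<^sup>2) has_integral
        integral {0..1} (\<lambda>t. (f t)\<^sup>2) - 2 * ?Y * ?Y + ?Y\<^sup>2) {0..1}"
      by (intro has_integral_add has_integral_diff has_integral_mult_right integrable_integral int)
  qed
  finally show ?thesis by (simp add: power2_eq_square)
qed

text \<open>The integrating factor \<open>m\<close> turns \<open>u' - p u\<close> into \<open>(m u)' / m\<close>; it is not periodic, so
  the boundary values of \<open>m u\<close> are controlled by its increment.\<close>

lemma poincare_inequality_integrating_factor:
  fixes m p :: "real \<Rightarrow> real"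
  assumes m: "\<And>t. t \<in> {0..1} \<Longrightarrow> (m has_real_derivative - p t * m t) (at t within {0..1})"
    and pos: "\<And>t. t \<in> {0..1} \<Longrightarrow> 0 < m t" and m1: "m 1 \<noteq> m 0"
    and p: "continuous_on {0..1} p"
  shows "\<exists>C>0. \<forall>(u :: real \<Rightarrow> complex) u'. (\<forall>t. (u has_vector_derivative u' t) (at t)) \<longrightarrow> continuous_on {0..1} u' \<longrightarrow>
    u 1 = u 0 \<longrightarrow> (L2_norm u)\<^sup>2 \<le> C * (L2_norm (\<lambda>t. u' t - p t * u t))\<^sup>2"
proof -
  have m_cont: "continuous_on {0..1} m"
    by (rule DERIV_continuous_on[OF m])
  have inv_cont: "continuous_on {0..1} (\<lambda>t. inverse (m t))"
    using pos by (intro continuous_intros m_cont) force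
  obtain M where M: "\<And>t. t \<in> {0..1} \<Longrightarrow> norm (m t) \<le> M"
    using continuous_on_Icc_norm_bounded[OF m_cont] by blast
  obtain K where K: "\<And>t. t \<in> {0..1} \<Longrightarrow> norm (inverse (m t)) \<le> K"
    using continuous_on_Icc_norm_bounded[OF inv_cont] by blast
  have "0 \<le> M" by (rule order_trans[OF norm_ge_zero M[of 0]]) simp
  have "0 \<le> K" by (rule order_trans[OF norm_ge_zero K[of 0]]) simp
  \<comment> \<open>Chosen so that \<open>cmod (u t)\<close> is at most \<open>D\<close> times the
    integral of \<open>cmod y\<close>: the first summand bounds \<open>m 0 * cmod (u 0)\<close>, the
    second the increment of \<open>m * u\<close>, and \<open>K\<close> undoes the factor
    \<open>m t\<close>.\<close>
  define D where "D = K * (m 0 * M / \<bar>m 1 - m 0\<bar> + M)"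
  \<comment> \<open>Adding 1 makes the constant strictly positive, as its reciprocal will be a
    coercivity constant.\<close>
  have "(L2_norm u)\<^sup>2 \<le> (D\<^sup>2 + 1) * (L2_norm (\<lambda>t. u' t - p t * u t))\<^sup>2"
    if u': "\<And>t. (u has_vector_derivative u' t) (at t)" and u'_cont: "continuous_on {0..1} u'"
      and u1: "u 1 = u 0" for u u' :: "real \<Rightarrow> complex"
  proof -
    have u_cont: "continuous_on {0..1} u"
      using u' has_vector_derivative_continuous continuous_at_imp_continuous_on by blast
    define y where "y t = u' t - p t * u t" for t
    have y_cont: "continuous_on {0..1} y"
      unfolding y_def by (intro continuous_intros u_cont u'_cont p)
    define Y where "Y = integral {0..1} (\<lambda>t. cmod (y t))"
    have Y_cont: "continuous_on {0..1} (\<lambda>t. cmod (y t))"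
      by (intro continuous_intros y_cont)
    have "0 \<le> Y"
      unfolding Y_def by (intro Henstock_Kurzweil_Integration.integral_nonneg
          integrable_continuous_interval Y_cont) simp
    \<comment> \<open>Since \<open>m' = - p m\<close>, the derivative of \<open>m * u\<close> is
      \<open>m * y\<close>.\<close>
    have increment: "cmod (m t * u t - m 0 * u 0) \<le> M * Y" if t: "t \<in> {0..1}" for t
    proof -
      have "((\<lambda>s. m s * y s) has_integral m t * u t - m 0 * u 0) {0..t}"
      proof (rule fundamental_theorem_of_calculus)
        fix s assume "s \<in> {0..t}"
        with t have s: "s \<in> {0..1}" and sub: "{0..t} \<subseteq> {0..1}" by auto
        have "((\<lambda>s. m s * u s) has_vector_derivative
            m s * u' s + complex_of_real (- p s * m s) * u s) (at s within {0..t})"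
          by (intro has_vector_derivative_mult has_vector_derivative_of_real
              DERIV_subset[OF m[OF s] sub]
              has_vector_derivative_at_within[OF u'])
        then show "((\<lambda>s. m s * u s) has_vector_derivative m s * y s) (at s within {0..t})"
          by (simp add: y_def algebra_simps)
      qed (use t in simp)
      then have "m t * u t - m 0 * u 0 = integral {0..t} (\<lambda>s. m s * y s)"
        by (simp add: integral_unique)
      also have "norm \<dots> \<le> integral {0..t} (\<lambda>s. M * cmod (y s))"
        using t M
        by (intro integral_norm_bound_integral integrable_continuous_interval continuous_intros
            continuous_on_subset[OF m_cont] continuous_on_subset[OF y_cont])
          (auto simp: norm_mult intro!: mult_right_mono)
      also have "\<dots> \<le> integral {0..1} (\<lambda>s. M * cmod (y s))"
        using t \<open>0 \<le> M\<close>
        by (intro integral_subset_le integrable_continuous_interval continuous_intros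
            continuous_on_subset[OF y_cont]) auto
      finally show ?thesis by (simp add: Y_def)
    qed
    \<comment> \<open>Because \<open>u 1 = u 0\<close>, the increment over the full period is
      \<open>(m 1 - m 0) * u 0\<close>, and \<open>m 1 \<noteq> m 0\<close> allows solving for
      \<open>u 0\<close>.\<close>
    have "\<bar>m 1 - m 0\<bar> * cmod (u 0) \<le> M * Y"
      using increment[of 1] by (simp add: u1 norm_mult flip: left_diff_distrib of_real_diff)
    then have u0: "m 0 * cmod (u 0) \<le> m 0 * M / \<bar>m 1 - m 0\<bar> * Y"
      using m1 pos[of 0] by (simp add: field_simps)
    have u_le: "cmod (u t) \<le> D * Y" if t: "t \<in> {0..1}" for t
    proof -
      have "cmod (m t * u t) \<le> cmod (m t * u t - m 0 * u 0) + cmod (m 0 * u 0)"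
        using norm_triangle_ineq[of "m t * u t - m 0 * u 0" "m 0 * u 0"] by simp
      also have "\<dots> \<le> M * Y + m 0 * M / \<bar>m 1 - m 0\<bar> * Y"
        using increment[OF t] u0 pos[of 0] by (intro add_mono) (simp_all add: norm_mult)
      also have "\<dots> = (m 0 * M / \<bar>m 1 - m 0\<bar> + M) * Y"
        by (simp only: distrib_right add.commute)
      finally have le: "m t * cmod (u t) \<le> (m 0 * M / \<bar>m 1 - m 0\<bar> + M) * Y"
        using pos[OF t] by (simp add: norm_mult)
      have "cmod (u t) = norm (inverse (m t)) * (m t * cmod (u t))"
        using pos[OF t] by simp
      also have "\<dots> \<le> K * ((m 0 * M / \<bar>m 1 - m 0\<bar> + M) * Y)"
        using pos[OF t] \<open>0 \<le> K\<close> by (intro mult_mono K t le) auto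
      finally show ?thesis by (simp add: D_def mult.assoc)
    qed
    have Y2: "Y\<^sup>2 \<le> (L2_norm y)\<^sup>2"
    proof -
      have c: "continuous_on {0..1} (\<lambda>t. (cmod (y t))\<^sup>2)"
        by (intro continuous_intros y_cont)
      show ?thesis
        using integral_power2_le_integral_of_power2[OF Y_cont]
          lebesgue_integral_eq_integral[OF continuous_imp_integrable_real[OF c]]
        by (simp add: Y_def L2_norm_power2)
    qed
    have "(L2_norm u)\<^sup>2 \<le> (LINT t|unit_interval_measure. (D * Y)\<^sup>2)"
      unfolding L2_norm_power2
    proof (rule integral_mono)
      show "integrable unit_interval_measure (\<lambda>t. (cmod (u t))\<^sup>2)"
        by (intro L2_unit_integrable_power2 continuous_in_L2_unit u_cont)
      show "(cmod (u t))\<^sup>2 \<le> (D * Y)\<^sup>2" if "t \<in> space unit_interval_measure" for t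
        using that by (intro power_mono u_le) auto
    qed simp
    also have "\<dots> = D\<^sup>2 * Y\<^sup>2"
      by (simp add: power_mult_distrib measure_restrict_space)
    also have "\<dots> \<le> (D\<^sup>2 + 1) * (L2_norm y)\<^sup>2"
      by (intro mult_mono Y2) auto
    finally show ?thesis unfolding y_def .
  qed
  then show ?thesis
    by (intro exI[of _ "D\<^sup>2 + 1"]) (auto intro: add_nonneg_pos)
qed

section \<open>The operators \<open>H_op h l\<close>\<close>

lemma H_op_eq_schroedinger: "H_op h l = schroedinger (potential h l)"
  unfolding H_op_def schroedinger_def ..

theorem proposition3:
  fixes h :: "real \<Rightarrow> real"
  assumes "smooth_real h" and "periodic1 h" and "\<And>t. h t > 0"
  shows "(\<forall>l::int. l \<noteq> 0 \<longrightarrow> strictly_pos_operator (H_op h l)) \<and> nonneg_operator (H_op h 0)"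
proof -
  have smooth: "(deriv ^^ n) h field_differentiable at t" for n t
    using assms(1) unfolding smooth_real_def by blast
  have h': "(h has_real_derivative deriv h t) (at t)" for t
    using smooth[of 0 t] by (simp add: DERIV_deriv_iff_field_differentiable)
  have h'': "(deriv h has_real_derivative deriv (deriv h) t) (at t)" for t
    using smooth[of 1 t] by (simp add: DERIV_deriv_iff_field_differentiable)
  have h''': "(deriv (deriv h) has_real_derivative deriv (deriv (deriv h)) t) (at t)" for t
    using smooth[of 2 t] by (simp add: DERIV_deriv_iff_field_differentiable numeral_2_eq_2)
  have h_cont: "continuous_on S h" "continuous_on S (deriv h)" "continuous_on S (deriv (deriv h))" for S
    by (intro continuous_at_imp_continuous_on ballI DERIV_isCont[OF h'] DERIV_isCont[OF h'']
        DERIV_isCont[OF h'''])+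
  have h_neq: "h t \<noteq> 0" for t
    using assms(3)[of t] by simp
  have h1: "h 1 = h 0"
    using assms(2) unfolding periodic1_def by (metis add_0)
  have h'1: "deriv h 1 = deriv h 0"
  proof -
    have "((\<lambda>t. h (t + 1)) has_real_derivative deriv h (0 + 1)) (at 0)"
      using h' DERIV_shift by blast
    then have "(h has_real_derivative deriv h 1) (at 0)"
      using assms(2) by (simp add: periodic1_def)
    then show ?thesis
      using h' DERIV_unique by blast
  qed
  define p where "p l t = 2 * pi * of_int l - deriv h t / h t" for l :: int and t
  define p' where "p' t = - ((deriv (deriv h) t * h t - deriv h t * deriv h t) / (h t * h t))" for t
  have p: "(p l has_real_derivative p' t) (at t within {0..1})" for l t
    unfolding p_def p'_def
    by (rule has_field_derivative_at_within)
      (auto intro!: derivative_eq_intros h' h'' simp: h_neq)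
  have p_cont: "continuous_on {0..1} (p l)" for l
    unfolding p_def by (intro continuous_intros h_cont) (simp add: h_neq)
  have p'_cont: "continuous_on {0..1} p'"
    unfolding p'_def by (intro continuous_intros h_cont) (simp add: h_neq)
  have p1: "p l 1 = p l 0" for l
    by (simp add: p_def h1 h'1)
  \<comment> \<open>The square of \<open>p\<close> contributes \<open>(h'/h)^2\<close> and
    \<open>p'\<close> contributes \<open>- h''/h + (h'/h)^2\<close>; together they give the last
    term of the potential.\<close>
  have V: "potential h l t = (p l t)\<^sup>2 + p' t" for l t
    using h_neq[of t] by (simp add: potential_def p_def p'_def field_simps power2_eq_square)
  have V_cont: "continuous_on {0..1} (potential h l)" for l
    unfolding V by (intro continuous_intros p_cont p'_cont)
  \<comment> \<open>The form of \<open>H - z\<close> is \<open>E - z * N\<close>, with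
    \<open>E\<close> and \<open>N\<close> the squared norms of \<open>B u\<close> and
    \<open>u\<close>.\<close>
  have form: "(LINT t|unit_interval_measure. cnj (u t) * (v t - z * u t))
      = complex_of_real ((L2_norm (\<lambda>t. u' t - p l t * u t))\<^sup>2) - z * complex_of_real ((L2_norm u)\<^sup>2)"
    if uv: "(u, v) \<in> schroedinger (potential h l)"
      and u': "\<And>t. (u has_vector_derivative u' t) (at t)" for u v u' :: "real \<Rightarrow> complex" and l z
  proof -
    note L2 = schroedinger_in_L2_unit[OF uv]
    have "(LINT t|unit_interval_measure. cnj (u t) * (v t - z * u t))
        = (LINT t|unit_interval_measure. cnj (u t) * v t - z * (cnj (u t) * u t))"
      by (simp add: algebra_simps)
    also have "\<dots> = (LINT t|unit_interval_measure. cnj (u t) * v t)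
        - z * (LINT t|unit_interval_measure. cnj (u t) * u t)"
      using L2_unit_mult_integrable[OF L2_unit_cnj[OF L2(1)] L2(1)]
        L2_unit_mult_integrable[OF L2_unit_cnj[OF L2(1)] L2(2)] by simp
    also have "(LINT t|unit_interval_measure. cnj (u t) * u t)
        = (LINT t|unit_interval_measure. complex_of_real ((cmod (u t))\<^sup>2))"
      by (simp only: complex_norm_square mult.commute)
    also have "\<dots> = complex_of_real ((L2_norm u)\<^sup>2)"
      unfolding L2_norm_power2 by (rule integral_complex_of_real)
    finally show ?thesis
      unfolding schroedinger_energy_identity[OF p p'_cont p1 V uv u'] .
  qed
  have resolvent: "z \<in> resolvent_set (H_op h l)" if z: "z \<notin> complex_of_real ` {0..}" for z l
  proof -
    obtain d where "0 < d" and d: "\<And>E N. 0 \<le> E \<Longrightarrow> 0 \<le> N \<Longrightarrow>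
        d * N \<le> cmod (complex_of_real E - z * complex_of_real N)"
      using distance_to_nonneg_reals[OF z] by blast
    show ?thesis
      unfolding H_op_eq_schroedinger
    proof (rule resolvent_set_of_coercive[OF V_cont \<open>0 < d\<close>])
      fix u v assume uv: "(u, v) \<in> schroedinger (potential h l)"
      then obtain u' where u': "\<And>t. (u has_vector_derivative u' t) (at t)"
        unfolding schroedinger_def periodic_H2_def by blast
      show "d * (L2_norm u)\<^sup>2 \<le> cmod (LINT t|unit_interval_measure. cnj (u t) * (v t - z * u t))"
        unfolding form[OF uv u'] by (rule d) simp_all
    qed
  qed
  have resolvent_0: "0 \<in> resolvent_set (H_op h l)" if l: "l \<noteq> 0" for l
  proof -
    \<comment> \<open>The reciprocal of the solution \<open>exp (2 \<pi> l t) / h\<close> of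
      \<open>B u = 0\<close>. Since \<open>h\<close> is periodic, the ratio of \<open>m 1\<close> to
      \<open>m 0\<close> is \<open>exp (- 2 \<pi> l)\<close>, which differs from 1 exactly when
      \<open>l \<noteq> 0\<close>.\<close>
    define m where "m t = h t * exp (- (2 * pi * of_int l * t))" for t
    have m: "(m has_real_derivative - p l t * m t) (at t within {0..1})" for t
      unfolding p_def m_def
      by (rule has_field_derivative_at_within)
        (auto intro!: derivative_eq_intros h' simp: h_neq field_simps)
    have m_pos: "0 < m t" for t
      by (simp add: m_def assms(3))
    have m1: "m 1 \<noteq> m 0"
      using l by (simp add: m_def h1 h_neq)
    obtain C where "0 < C" and C: "\<And>(u :: real \<Rightarrow> complex) u'. (\<And>t. (u has_vector_derivative u' t) (at t)) \<Longrightarrow>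
        continuous_on {0..1} u' \<Longrightarrow> u 1 = u 0 \<Longrightarrow>
        (L2_norm u)\<^sup>2 \<le> C * (L2_norm (\<lambda>t. u' t - p l t * u t))\<^sup>2"
      using poincare_inequality_integrating_factor[OF m m_pos m1 p_cont] by blast
    show ?thesis
      unfolding H_op_eq_schroedinger
    proof (rule resolvent_set_of_coercive[OF V_cont])
      \<comment> \<open>At \<open>z = 0\<close> the form is the squared norm of \<open>B u\<close>,
        so the Poincare constant \<open>C\<close> yields coercivity with constant
        \<open>1 / C\<close>.\<close>
      show "0 < 1 / C" using \<open>0 < C\<close> by simp
      fix u v assume uv: "(u, v) \<in> schroedinger (potential h l)"
      then obtain w where w: "periodic_H2 u w"
        unfolding schroedinger_def by blast
      obtain u' where u': "\<And>t. (u has_vector_derivative u' t) (at t)"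
        using w unfolding periodic_H2_def by blast
      then have "(L2_norm u)\<^sup>2 \<le> C * (L2_norm (\<lambda>t. u' t - p l t * u t))\<^sup>2"
        by (intro C periodic_H2D(2,4)[OF w])
      then show "1 / C * (L2_norm u)\<^sup>2
          \<le> cmod (LINT t|unit_interval_measure. cnj (u t) * (v t - 0 * u t))"
        unfolding form[OF uv u'] using \<open>0 < C\<close> by (simp add: norm_power field_simps)
    qed
  qed
  have nonneg: "spectrum (H_op h l) \<subseteq> complex_of_real ` {0..}" for l
    unfolding spectrum_def using resolvent[of _ l] by auto
  have "spectrum (H_op h l) \<subseteq> complex_of_real ` {0<..}" if "l \<noteq> 0" for l
  proof
    fix z assume z: "z \<in> spectrum (H_op h l)"
    then have "z \<noteq> 0"
      unfolding spectrum_def using resolvent_0[OF that] by auto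
    moreover obtain r where "z = complex_of_real r" "0 \<le> r"
      using subsetD[OF nonneg z] by auto
    ultimately show "z \<in> complex_of_real ` {0<..}"
      by (intro image_eqI[of _ _ r]) auto
  qed
  with nonneg show ?thesis
    unfolding strictly_pos_operator_def nonneg_operator_def by simp
qed

end
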